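(* Let $\Omega\subset\mathbb{C}^n$ be a bounded pseudoconvex Hölder domain. Then there exist constants $0<\alpha<1$, $\beta>0$, $A>0$, $C_1,C_2>0$ and $\alpha_1\in(-1,0)$ (depending only on $\Omega$) with the following property. Let $\psi(t):=-C_1(-\log(-t))^{-\beta}$ for $t\in(-1,0)$ (an increasing bijection $(-1,0)\to(-\infty,0)$) and $\varphi(t):=-C_2\exp(-A/(-t)^{1/\alpha-1})$ for $t<0$; define recursively $\alpha_{\nu+1}:=\psi^{-1}(\varphi(\alpha_\nu)/2)$ (an increasing sequence of negative numbers tending to $0$), and for $0<t<-\alpha_1$ set $\lambda(t):=\max\{\nu\in\mathbb{Z}^+:\ \alpha_\nu\le -t\}$. Then for every closed ball $\overline{B}\subset\Omega$ there are constants $\varepsilon_0>0$ and $c>0$, depending only on $\Omega$ and $\overline{B}$, such that \[ \varrho_{\Omega,\overline{B}}(z)\ge -c\,e^{-\varepsilon_0\lambda(\delta_\Omega(z))} \] for all $z\in\Omega$ with $\delta_\Omega(z)<-\alpha_1$.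
   Context: $\delta_\Omega$ is the Euclidean distance to $\partial\Omega$. A bounded domain $\Omega$ is a Hölder domain if there exist a finite open cover $\{V_j\}$ of $\partial\Omega$, points $p_j\in V_j$, unit vectors $v_j\in\mathbb{C}^n$, neighbourhoods $V_j'$ of $0$ in the real hyperplane $\{w:\mathrm{Re}\langle w,v_j\rangle=0\}$ with $\pi_{v_j}(w-p_j)\in V_j'$ for all $w\in V_j$ ($\pi_{v}$ the orthogonal projection onto that hyperplane, $\langle z,w\rangle=\sum z_k\overline{w_k}$), and Hölder continuous functions $h_j$ of order $\alpha_j\in(0,1]$ on $V_j'$ with $h_j(0)=0$, such that $\Omega\cap V_j=\{w\in V_j:\ \mathrm{Re}\langle w-p_j,v_j\rangle>h_j(\pi_{v_j}(w-p_j))\}$. The relative extremal function is $\varrho_{\Omega,\overline{B}}(z):=\sup\{u(z):\ u$ negative plurisubharmonic on $\Omega$, $u\le-1$ on $\overline{B}\}$. *)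

theory Defs
  imports "HOL-Analysis.Analysis"
begin

definition cinner :: "complex^'n \<Rightarrow> complex^'n \<Rightarrow> complex" where
  "cinner z w = (\<Sum>k\<in>UNIV. z $ k * cnj (w $ k))"

text \<open>Orthogonal projection onto the real hyperplane {w. Re (cinner w v) = 0},
  for a unit vector v (C^n viewed as R^2n with real inner product Re cinner).\<close>
definition hproj :: "complex^'n \<Rightarrow> complex^'n \<Rightarrow> complex^'n" where
  "hproj v w = w - Re (cinner w v) *\<^sub>R v"

definition bdist :: "(complex^'n) set \<Rightarrow> complex^'n \<Rightarrow> real" where
  "bdist \<Omega> z = infdist z (frontier \<Omega>)"

definition usc_on :: "'a::topological_space set \<Rightarrow> ('a \<Rightarrow> ereal) \<Rightarrow> bool" where
  "usc_on U v \<longleftrightarrow> (\<forall>c::real. openin (top_of_set U) {x\<in>U. v x < ereal c})"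

definition harmonic_on_ball :: "complex \<Rightarrow> real \<Rightarrow> (complex \<Rightarrow> real) \<Rightarrow> bool" where
  "harmonic_on_ball c r h \<longleftrightarrow>
     (\<exists>f. f holomorphic_on ball c r \<and> (\<forall>\<zeta>\<in>ball c r. h \<zeta> = Re (f \<zeta>)))"

definition subharmonic_on :: "complex set \<Rightarrow> (complex \<Rightarrow> ereal) \<Rightarrow> bool" where
  "subharmonic_on U v \<longleftrightarrow> open U \<and> (\<forall>x\<in>U. v x < \<infinity>) \<and> usc_on U v \<and>
     (\<forall>c r h. cball c r \<subseteq> U \<longrightarrow> continuous_on (cball c r) h \<longrightarrow> harmonic_on_ball c r h \<longrightarrow>
        (\<forall>\<zeta>\<in>sphere c r. v \<zeta> \<le> ereal (h \<zeta>)) \<longrightarrow> (\<forall>\<zeta>\<in>cball c r. v \<zeta> \<le> ereal (h \<zeta>)))"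

definition psh_on :: "(complex^'n) set \<Rightarrow> (complex^'n \<Rightarrow> ereal) \<Rightarrow> bool" where
  "psh_on \<Omega> u \<longleftrightarrow> open \<Omega> \<and> (\<forall>x\<in>\<Omega>. u x < \<infinity>) \<and> usc_on \<Omega> u \<and>
     (\<forall>a b. subharmonic_on {\<zeta>. a + \<zeta> *s b \<in> \<Omega>} (\<lambda>\<zeta>. u (a + \<zeta> *s b)))"

definition pseudoconvex_domain :: "(complex^'n) set \<Rightarrow> bool" where
  "pseudoconvex_domain \<Omega> \<longleftrightarrow> open \<Omega> \<and> connected \<Omega> \<and> \<Omega> \<noteq> {} \<and>
     psh_on \<Omega> (\<lambda>z. ereal (- ln (bdist \<Omega> z)))"

definition holder_on :: "real \<Rightarrow> 'a::metric_space set \<Rightarrow> ('a \<Rightarrow> real) \<Rightarrow> bool" where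
  "holder_on a S h \<longleftrightarrow> (\<exists>C. \<forall>x\<in>S. \<forall>y\<in>S. \<bar>h x - h y\<bar> \<le> C * dist x y powr a)"

definition holder_domain :: "(complex^'n) set \<Rightarrow> bool" where
  "holder_domain \<Omega> \<longleftrightarrow> bounded \<Omega> \<and> open \<Omega> \<and> connected \<Omega> \<and> \<Omega> \<noteq> {} \<and>
    (\<exists>(J::nat set) V p v V' h a. finite J \<and> frontier \<Omega> \<subseteq> (\<Union>j\<in>J. V j) \<and>
      (\<forall>j\<in>J. open (V j) \<and> p j \<in> V j \<and> norm (v j) = 1 \<and>
         V' j \<subseteq> {w. Re (cinner w (v j)) = 0} \<and>
         openin (top_of_set {w. Re (cinner w (v j)) = 0}) (V' j) \<and> 0 \<in> V' j \<and>
         (\<forall>w\<in>V j. hproj (v j) (w - p j) \<in> V' j) \<and>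
         0 < a j \<and> a j \<le> 1 \<and> holder_on (a j) (V' j) (h j) \<and> h j 0 = 0 \<and>
         \<Omega> \<inter> V j = {w\<in>V j. Re (cinner (w - p j) (v j)) > h j (hproj (v j) (w - p j))}))"

definition rel_extremal :: "(complex^'n) set \<Rightarrow> complex^'n \<Rightarrow> real \<Rightarrow> complex^'n \<Rightarrow> ereal" where
  "rel_extremal \<Omega> p r z = (SUP u\<in>{u. psh_on \<Omega> u \<and> (\<forall>x\<in>\<Omega>. u x < 0) \<and> (\<forall>x\<in>cball p r. u x \<le> -1)}. u z)"

text \<open>The sequence (alpha_nu), shifted: aseq ... k = alpha_(k+1).\<close>
primrec aseq :: "(real \<Rightarrow> real) \<Rightarrow> real \<Rightarrow> nat \<Rightarrow> real" where
  "aseq g a1 0 = a1"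
| "aseq g a1 (Suc k) = g (aseq g a1 k)"

end

theory Submission
  imports Defs "HOL-Complex_Analysis.Complex_Analysis" "HOL-Real_Asymp.Real_Asymp"
begin

text \<open>Write \<open>\<delta>\<close> for the boundary distance. Near a boundary point, translating \<open>\<Omega>\<close> by \<open>s v\<close> along the
  graph direction gives the plurisubharmonic function \<open>V s z = - ln (\<delta> (z + s v))\<close>. It is at least
  \<open>- ln (2 s)\<close> where \<open>\<delta> z \<le> s\<close> and, by Hoelder continuity, at most \<open>q ln (1 / s)\<close> everywhere.
  Normalised, it lifts a lower bound for a negative plurisubharmonic function by a fixed factor
  \<open>\<theta> < 1\<close> each time \<open>\<delta>\<close> passes from \<open>t\<close> to \<open>t ^ 8\<close>. Iterating yields local barriers \<open>f\<close> that are
  comparable, up to a factor \<open>2\<close>, to \<open>- \<theta> ^ n\<close>, with \<open>n\<close> the number of scales below which \<open>\<delta>\<close> lies.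
  The functions \<open>- ln (- f)\<close> of two charts thus differ by at most \<open>ln 2\<close>, so they can be glued by
  a maximum. After normalisation the relative extremal function is at least \<open>- C / k\<close> as soon as
  \<open>\<delta> < t\<^sub>0 ^ (8 ^ k)\<close>. With \<open>\<alpha> = 1/2\<close>, \<open>\<beta> = A = C\<^sub>1 = 1\<close>, \<open>C\<^sub>2 = 2\<close>, \<open>\<alpha>\<^sub>1 = - 1/2\<close> the recursion becomes
  \<open>1 / \<bar>\<alpha>\<^sub>\<nu>\<^sub>+\<^sub>1\<bar> = exp (exp (1 / \<bar>\<alpha>\<^sub>\<nu>\<bar>))\<close>, a tower so fast that \<open>k = 2 ^ (\<lambda> - 1)\<close> is admissible for
  all large \<open>\<lambda>\<close>.\<close>

section \<open>Continuous plurisubharmonic functions\<close>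

text \<open>The continuous real-valued case of \<open>psh_on\<close>, with slices and discs under
  one quantifier. Every function constructed below is continuous, so extended reals and
  semicontinuity enter only in the conversions to and from \<open>psh_on\<close>.\<close>

definition psh_real :: "(complex^'n) set \<Rightarrow> (complex^'n \<Rightarrow> real) \<Rightarrow> bool" where
  "psh_real U f \<longleftrightarrow> open U \<and> continuous_on U f \<and>
     (\<forall>a b c r h. (\<forall>\<zeta>\<in>cball c r. a + \<zeta> *s b \<in> U) \<longrightarrow> continuous_on (cball c r) h \<longrightarrow>
        harmonic_on_ball c r h \<longrightarrow> (\<forall>\<zeta>\<in>sphere c r. f (a + \<zeta> *s b) \<le> h \<zeta>) \<longrightarrow>
        (\<forall>\<zeta>\<in>cball c r. f (a + \<zeta> *s b) \<le> h \<zeta>))"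

lemma psh_realI:
  assumes "open U" "continuous_on U f"
    and "\<And>a b c r h \<zeta>. \<lbrakk>\<And>\<zeta>. \<zeta> \<in> cball c r \<Longrightarrow> a + \<zeta> *s b \<in> U; continuous_on (cball c r) h;
        harmonic_on_ball c r h; \<And>\<zeta>. \<zeta> \<in> sphere c r \<Longrightarrow> f (a + \<zeta> *s b) \<le> h \<zeta>; \<zeta> \<in> cball c r\<rbrakk>
        \<Longrightarrow> f (a + \<zeta> *s b) \<le> h \<zeta>"
  shows "psh_real U f"
  using assms unfolding psh_real_def by blast

lemma psh_realD:
  assumes "psh_real U f" "\<And>\<zeta>. \<zeta> \<in> cball c r \<Longrightarrow> a + \<zeta> *s b \<in> U"
    "continuous_on (cball c r) h" "harmonic_on_ball c r h"
    "\<And>\<zeta>. \<zeta> \<in> sphere c r \<Longrightarrow> f (a + \<zeta> *s b) \<le> h \<zeta>" "\<zeta> \<in> cball c r"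
  shows "f (a + \<zeta> *s b) \<le> h \<zeta>"
  using assms unfolding psh_real_def by blast

lemma psh_real_open: "psh_real U f \<Longrightarrow> open U"
  and psh_real_continuous: "psh_real U f \<Longrightarrow> continuous_on U f"
  by (auto simp: psh_real_def)

lemma psh_real_subset:
  assumes "psh_real U f" "open W" "W \<subseteq> U"
  shows "psh_real W f"
proof (rule psh_realI)
  show "continuous_on W f"
    using assms continuous_on_subset psh_real_continuous by blast
  show "f (a + \<zeta> *s b) \<le> h \<zeta>"
    if "\<And>\<zeta>. \<zeta> \<in> cball c r \<Longrightarrow> a + \<zeta> *s b \<in> W" "continuous_on (cball c r) h" "harmonic_on_ball c r h"
      "\<And>\<zeta>. \<zeta> \<in> sphere c r \<Longrightarrow> f (a + \<zeta> *s b) \<le> h \<zeta>" "\<zeta> \<in> cball c r" for a b c r h \<zeta>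
    by (rule psh_realD[OF assms(1) _ that(2-5)]) (use that(1) assms(3) in auto)
qed (rule assms)

lemma psh_real_cong:
  assumes "psh_real U f" "\<And>z. z \<in> U \<Longrightarrow> g z = f z"
  shows "psh_real U g"
proof (rule psh_realI)
  show "continuous_on U g"
    using assms psh_real_continuous by (metis continuous_on_cong)
  fix a b c r h \<zeta>
  assume *: "\<And>\<zeta>. \<zeta> \<in> cball c r \<Longrightarrow> a + \<zeta> *s b \<in> U" "continuous_on (cball c r) h"
    "harmonic_on_ball c r h" "\<And>\<zeta>. \<zeta> \<in> sphere c r \<Longrightarrow> g (a + \<zeta> *s b) \<le> h \<zeta>" "\<zeta> \<in> cball c r"
  have "f (a + \<zeta> *s b) \<le> h \<zeta>"
    by (rule psh_realD[OF assms(1) *(1-3) _ *(5)])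
       (use * assms(2) sphere_cball in \<open>metis subsetD\<close>)+
  thus "g (a + \<zeta> *s b) \<le> h \<zeta>" using * assms(2) by simp
qed (use assms in \<open>auto simp: psh_real_open\<close>)

lemma continuous_on_slice:
  fixes a b :: "complex^'n"
  shows "continuous_on S (\<lambda>\<zeta>. a + \<zeta> *s b)"
  by (auto simp: vector_scalar_mult_def intro!: continuous_intros)

lemma harmonic_on_ball_affine:
  assumes "harmonic_on_ball c r h" "e \<ge> 0"
  shows "harmonic_on_ball c r (\<lambda>\<zeta>. e * h \<zeta> + Re (m * \<zeta>) + d)"
proof -
  obtain f where f: "f holomorphic_on ball c r" "\<forall>\<zeta>\<in>ball c r. h \<zeta> = Re (f \<zeta>)"
    using assms unfolding harmonic_on_ball_def by blast
  show ?thesis unfolding harmonic_on_ball_def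
    by (rule exI[of _ "\<lambda>\<zeta>. of_real e * f \<zeta> + m * \<zeta> + of_real d"])
       (use f in \<open>auto intro!: holomorphic_intros\<close>)
qed

lemma harmonic_on_ball_subset:
  assumes "harmonic_on_ball c r h" "ball c' r' \<subseteq> ball c r"
  shows "harmonic_on_ball c' r' h"
  using assms unfolding harmonic_on_ball_def by (meson holomorphic_on_subset subsetD)

lemma Re_cinner: "Re (cinner z w) = z \<bullet> w"
  unfolding cinner_def inner_vec_def inner_complex_def by (simp add: Re_sum)

text \<open>Real linear functionals are pluriharmonic: on a complex line they are the real part of
  an affine holomorphic function of \<open>\<zeta>\<close>.\<close>

lemma inner_slice: "(a + \<zeta> *s b) \<bullet> m = Re (cinner b m * \<zeta>) + a \<bullet> m"
proof -
  have "cinner (a + \<zeta> *s b) m = cinner a m + cinner b m * \<zeta>"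
    unfolding cinner_def by (simp add: algebra_simps sum.distrib sum_distrib_left)
  thus ?thesis by (metis Re_cinner add.commute plus_complex.sel(1))
qed

lemma psh_real_affine:
  assumes f: "psh_real U f" and "e > 0"
  shows "psh_real U (\<lambda>z. e * f z + z \<bullet> m + d)"
proof (rule psh_realI)
  show "open U" "continuous_on U (\<lambda>z. e * f z + z \<bullet> m + d)"
    using psh_real_open[OF f] psh_real_continuous[OF f] by (auto intro!: continuous_intros)
  fix a b c r h \<zeta>
  assume *: "\<And>\<zeta>. \<zeta> \<in> cball c r \<Longrightarrow> a + \<zeta> *s b \<in> U" "continuous_on (cball c r) h"
    "harmonic_on_ball c r h" "\<And>\<zeta>. \<zeta> \<in> sphere c r \<Longrightarrow> e * f (a + \<zeta> *s b) + (a + \<zeta> *s b) \<bullet> m + d \<le> h \<zeta>"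
    "\<zeta> \<in> cball c r"
  let ?g = "\<lambda>\<zeta>. (1/e) * h \<zeta> + Re (- cinner b m / e * \<zeta>) + (- (a \<bullet> m + d) / e)"
  have g: "?g \<zeta> = (h \<zeta> - (a + \<zeta> *s b) \<bullet> m - d) / e" for \<zeta>
    by (simp only: inner_slice) (use \<open>e > 0\<close> in \<open>simp add: field_simps Re_divide_of_real\<close>)
  have "f (a + \<zeta> *s b) \<le> ?g \<zeta>"
  proof (rule psh_realD[OF f *(1) _ _ _ *(5)])
    show "continuous_on (cball c r) ?g" using *(2) by (intro continuous_intros) auto
    show "harmonic_on_ball c r ?g" by (rule harmonic_on_ball_affine[OF *(3)]) (use \<open>e > 0\<close> in simp)
    show "f (a + \<zeta> *s b) \<le> ?g \<zeta>" if "\<zeta> \<in> sphere c r" for \<zeta>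
      unfolding g using *(4)[OF that] \<open>e > 0\<close> by (simp add: field_simps)
  qed
  thus "e * f (a + \<zeta> *s b) + (a + \<zeta> *s b) \<bullet> m + d \<le> h \<zeta>"
    unfolding g using \<open>e > 0\<close> by (simp add: field_simps)
qed

lemma psh_real_max:
  assumes "psh_real U f" "psh_real U g"
  shows "psh_real U (\<lambda>z. max (f z) (g z))"
proof (rule psh_realI)
  show "open U" "continuous_on U (\<lambda>z. max (f z) (g z))"
    using assms psh_real_open psh_real_continuous by (auto intro!: continuous_intros)
  fix a b c r h \<zeta>
  assume *: "\<And>\<zeta>. \<zeta> \<in> cball c r \<Longrightarrow> a + \<zeta> *s b \<in> U" "continuous_on (cball c r) h"
    "harmonic_on_ball c r h" "\<zeta> \<in> cball c r"
    "\<And>\<zeta>. \<zeta> \<in> sphere c r \<Longrightarrow> max (f (a + \<zeta> *s b)) (g (a + \<zeta> *s b)) \<le> h \<zeta>"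
  have "f (a + \<zeta> *s b) \<le> h \<zeta>"
    by (rule psh_realD[OF assms(1) *(1-3) _ *(4)]) (use *(5) in auto)
  moreover have "g (a + \<zeta> *s b) \<le> h \<zeta>"
    by (rule psh_realD[OF assms(2) *(1-3) _ *(4)]) (use *(5) in auto)
  ultimately show "max (f (a + \<zeta> *s b)) (g (a + \<zeta> *s b)) \<le> h \<zeta>" by simp
qed

lemma psh_real_Max:
  assumes "finite P" "P \<noteq> {}" "\<And>p. p \<in> P \<Longrightarrow> psh_real U (f p)"
  shows "psh_real U (\<lambda>z. Max ((\<lambda>p. f p z) ` P))"
  using assms
proof (induction P rule: finite_ne_induct)
  case (insert p P)
  hence "psh_real U (\<lambda>z. max (f p z) (Max ((\<lambda>p. f p z) ` P)))"
    by (intro psh_real_max) auto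
  thus ?case by (rule psh_real_cong) (use insert in auto)
qed auto

text \<open>\<open>- ln (- u)\<close> is the supremum of the increasing affine functions
  \<open>u / s + 1 - ln s\<close> of \<open>u\<close>, \<open>s > 0\<close>, with equality at \<open>s = - u\<close>.\<close>

lemma psh_real_minus_ln:
  assumes f: "psh_real U f" and neg: "\<And>z. z \<in> U \<Longrightarrow> f z < 0"
  shows "psh_real U (\<lambda>z. - ln (- f z))"
proof (rule psh_realI)
  show "open U" "continuous_on U (\<lambda>z. - ln (- f z))"
    using psh_real_open[OF f] psh_real_continuous[OF f] neg
    by (force intro!: continuous_intros)+
  fix a b c r h \<zeta>
  assume *: "\<And>\<zeta>. \<zeta> \<in> cball c r \<Longrightarrow> a + \<zeta> *s b \<in> U" "continuous_on (cball c r) h"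
    "harmonic_on_ball c r h" "\<And>\<zeta>. \<zeta> \<in> sphere c r \<Longrightarrow> - ln (- f (a + \<zeta> *s b)) \<le> h \<zeta>"
    "\<zeta> \<in> cball c r"
  define s where "s = - f (a + \<zeta> *s b)"
  have s: "s > 0" using neg[OF *(1)[OF *(5)]] by (simp add: s_def)
  have "psh_real U (\<lambda>z. (1/s) * f z + z \<bullet> 0 + (1 - ln s))"
    using s by (intro psh_real_affine f) auto
  hence "(1/s) * f (a + \<zeta> *s b) + (a + \<zeta> *s b) \<bullet> 0 + (1 - ln s) \<le> h \<zeta>"
  proof (rule psh_realD[OF _ *(1-3) _ *(5)])
    fix \<zeta> assume \<zeta>: "\<zeta> \<in> sphere c r"
    let ?u = "- f (a + \<zeta> *s b)"
    have u: "?u > 0" using neg[OF *(1)] \<zeta> by auto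
    have "ln (?u / s) \<le> ?u / s - 1" using u s by (intro ln_le_minus_one divide_pos_pos)
    moreover have "ln (?u / s) = ln ?u - ln s" using u s by (intro ln_divide_pos) auto
    ultimately show "(1/s) * f (a + \<zeta> *s b) + (a + \<zeta> *s b) \<bullet> 0 + (1 - ln s) \<le> h \<zeta>"
      using *(4)[OF \<zeta>] by simp
  qed auto
  thus "- ln (- f (a + \<zeta> *s b)) \<le> h \<zeta>" using s by (simp add: s_def divide_neg_pos)
qed

lemma psh_real_translate:
  assumes "psh_real U f" "open W" "\<And>z. z \<in> W \<Longrightarrow> z + w \<in> U"
  shows "psh_real W (\<lambda>z. f (z + w))"
proof (rule psh_realI)
  show "continuous_on W (\<lambda>z. f (z + w))"
    by (rule continuous_on_compose2[OF psh_real_continuous[OF assms(1)]])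
       (use assms(3) in \<open>auto intro!: continuous_intros\<close>)
  fix a b c r h \<zeta>
  assume *: "\<And>\<zeta>. \<zeta> \<in> cball c r \<Longrightarrow> a + \<zeta> *s b \<in> W" "continuous_on (cball c r) h"
    "harmonic_on_ball c r h" "\<And>\<zeta>. \<zeta> \<in> sphere c r \<Longrightarrow> f (a + \<zeta> *s b + w) \<le> h \<zeta>"
    "\<zeta> \<in> cball c r"
  have eq: "a + \<zeta> *s b + w = (a + w) + \<zeta> *s b" for \<zeta> by simp
  show "f (a + \<zeta> *s b + w) \<le> h \<zeta>"
    unfolding eq
    by (rule psh_realD[OF assms(1) _ *(2,3) _ *(5)])
       (use * assms(3) in \<open>auto simp flip: eq\<close>)
qed (use assms in auto)

text \<open>A maximum principle by tilting. If the maximum \<open>M\<close> were positive, take a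
  maximum point farthest from a fixed point \<open>c'\<close>. The maximum points on a small circle
  around it lie strictly to one side, so some affine function dominates \<open>\<phi>\<close> on the
  circle and is yet smaller than \<open>M\<close> at the centre.\<close>

lemma nonpos_of_local_linear_majorant:
  fixes \<phi> :: "complex \<Rightarrow> real"
  assumes cont: "continuous_on (cball c r) \<phi>" and bd: "\<And>\<zeta>. \<zeta> \<in> sphere c r \<Longrightarrow> \<phi> \<zeta> \<le> 0"
    and loc: "\<And>\<zeta>0. \<zeta>0 \<in> ball c r \<Longrightarrow> \<exists>\<rho>>0. cball \<zeta>0 \<rho> \<subseteq> ball c r \<and>
       (\<forall>m d. (\<forall>\<zeta>\<in>sphere \<zeta>0 \<rho>. \<phi> \<zeta> \<le> Re (m * \<zeta>) + d) \<longrightarrow> \<phi> \<zeta>0 \<le> Re (m * \<zeta>0) + d)"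
    and \<zeta>: "\<zeta> \<in> cball c r"
  shows "\<phi> \<zeta> \<le> 0"
proof (rule ccontr)
  assume pos: "\<not> \<phi> \<zeta> \<le> 0"
  obtain \<xi> where \<xi>: "\<xi> \<in> cball c r" "\<And>w. w \<in> cball c r \<Longrightarrow> \<phi> w \<le> \<phi> \<xi>"
    using continuous_attains_sup[OF compact_cball _ cont] \<zeta> by blast
  define M where "M = \<phi> \<xi>"
  have M: "M > 0" "\<And>w. w \<in> cball c r \<Longrightarrow> \<phi> w \<le> M"
    using \<xi> \<zeta> pos unfolding M_def by fastforce+
  define E where "E = cball c r \<inter> \<phi> -` {M}"
  have "closed E" unfolding E_def
    by (intro continuous_closed_preimage cont) auto
  moreover have "bounded E" unfolding E_def using bounded_subset by blast
  ultimately have E: "compact E" "E \<noteq> {}" using \<xi> by (auto simp: E_def M_def compact_eq_bounded_closed)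
  define c' where "c' = c - of_real (r + 1)"
  obtain \<zeta>0 where \<zeta>0: "\<zeta>0 \<in> E" and far: "\<And>w. w \<in> E \<Longrightarrow> dist w c' \<le> dist \<zeta>0 c'"
    using continuous_attains_sup[OF E continuous_on_dist[OF continuous_on_id continuous_on_const], of c'] by auto
  have "\<zeta>0 \<in> ball c r"
    using \<zeta>0 bd[of \<zeta>0] M by (auto simp: E_def less_eq_real_def)
  then obtain \<rho> where \<rho>: "\<rho> > 0" "cball \<zeta>0 \<rho> \<subseteq> ball c r"
    and maj: "\<And>m d. (\<And>\<zeta>. \<zeta> \<in> sphere \<zeta>0 \<rho> \<Longrightarrow> \<phi> \<zeta> \<le> Re (m * \<zeta>) + d) \<Longrightarrow> \<phi> \<zeta>0 \<le> Re (m * \<zeta>0) + d"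
    using loc by meson
  have sph: "sphere \<zeta>0 \<rho> \<subseteq> cball c r"
    using \<rho>(2) by (meson ball_subset_cball order_trans sphere_cball)
  define l where "l w = (w - \<zeta>0) \<bullet> (\<zeta>0 - c')" for w
  \<comment> \<open>The threshold lies between \<open>l \<zeta>0 = 0\<close> and the bound
    \<open>- (\<rho>\<^sup>2 / 2)\<close> for maximum points on the circle. Hence the compact set
    \<open>Y\<close> contains no maximum point, and \<open>\<phi>\<close> stays below some
    \<open>M' < M\<close> there.\<close>
  define Y where "Y = sphere \<zeta>0 \<rho> \<inter> {w. l w \<ge> - (\<rho>\<^sup>2 / 4)}"
  have lE: "l w \<le> - (\<rho>\<^sup>2 / 2)" if "w \<in> E" "w \<in> sphere \<zeta>0 \<rho>" for w
  proof -
    have "(norm (w - c'))\<^sup>2 \<le> (norm (\<zeta>0 - c'))\<^sup>2"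
      using far[OF that(1)] by (simp add: dist_norm)
    moreover have "(norm (w - c'))\<^sup>2 = (norm (\<zeta>0 - c'))\<^sup>2 + 2 * l w + (norm (w - \<zeta>0))\<^sup>2"
    proof -
      have "w - c' = (w - \<zeta>0) + (\<zeta>0 - c')" by simp
      thus ?thesis unfolding l_def by (metis add.assoc add.commute power2_norm_eq_inner
          dot_norm inner_add inner_commute mult_2)
    qed
    moreover have "norm (w - \<zeta>0) = \<rho>" using that by (simp add: dist_norm norm_minus_commute)
    ultimately show ?thesis by simp
  qed
  have "\<exists>M'<M. \<forall>w\<in>Y. \<phi> w \<le> M'"
  proof (cases "Y = {}")
    case True thus ?thesis using lt_ex by auto
  next
    case False
    have "closed {w. l w \<ge> - (\<rho>\<^sup>2 / 4)}" unfolding l_def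
      by (intro closed_Collect_le continuous_intros)
    hence "compact Y" unfolding Y_def by (intro compact_Int_closed compact_sphere)
    moreover have "continuous_on Y \<phi>" using continuous_on_subset[OF cont] sph unfolding Y_def by blast
    ultimately obtain y where y: "y \<in> Y" "\<And>w. w \<in> Y \<Longrightarrow> \<phi> w \<le> \<phi> y"
      using continuous_attains_sup[OF _ False] by blast
    have "\<rho>\<^sup>2 > 0" using \<rho>(1) by simp
    hence "y \<notin> E" using lE[of y] y(1) unfolding Y_def Int_iff mem_Collect_eq by linarith
    hence "\<phi> y < M" using M(2)[of y] y(1) sph unfolding E_def Y_def by fastforce
    thus ?thesis using y by blast
  qed
  then obtain M' where M': "M' < M" "\<And>w. w \<in> Y \<Longrightarrow> \<phi> w \<le> M'" by blast
  \<comment> \<open>\<open>L\<close> bounds \<open>l + \<rho>\<^sup>2 / 4\<close> on the circle, so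
    the tilt \<open>\<eta>\<close> costs at most the gap \<open>M - M'\<close> on
    \<open>Y\<close>.\<close>
  define L where "L = \<rho> * norm (\<zeta>0 - c') + \<rho>\<^sup>2 / 4"
  have L: "L > 0" unfolding L_def using \<rho>(1) by (auto intro!: add_nonneg_pos)
  define \<eta> where "\<eta> = (M - M') / L"
  have \<eta>: "\<eta> > 0" "\<eta> * L = M - M'" using L M' by (auto simp: \<eta>_def)
  define m where "m = - of_real \<eta> * cnj (\<zeta>0 - c')"
  define d where "d = M - \<eta> * \<rho>\<^sup>2 / 4 - Re (m * \<zeta>0)"
  have g: "Re (m * w) + d = M - \<eta> * (l w + \<rho>\<^sup>2 / 4)" for w
    unfolding m_def d_def l_def by (simp add: inner_complex_def algebra_simps)
  have "\<phi> \<zeta>0 \<le> Re (m * \<zeta>0) + d"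
  proof (rule maj)
    fix w assume w: "w \<in> sphere \<zeta>0 \<rho>"
    show "\<phi> w \<le> Re (m * w) + d"
    proof (cases "w \<in> Y")
      case True
      have "l w \<le> norm (w - \<zeta>0) * norm (\<zeta>0 - c')" unfolding l_def by (rule norm_cauchy_schwarz)
      also have "norm (w - \<zeta>0) = \<rho>" using w by (simp add: dist_norm norm_minus_commute)
      finally have "\<eta> * (l w + \<rho>\<^sup>2 / 4) \<le> \<eta> * L" using \<eta>(1) by (simp add: L_def)
      thus ?thesis unfolding g using M'(2)[OF True] \<eta>(2) by linarith
    next
      case False
      hence "l w + \<rho>\<^sup>2 / 4 \<le> 0" using w by (auto simp: Y_def)
      hence "\<eta> * (l w + \<rho>\<^sup>2 / 4) \<le> 0" using \<eta>(1) by (simp add: mult_le_0_iff)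
      thus ?thesis unfolding g using M(2)[of w] sph w by fastforce
    qed
  qed
  moreover have "\<eta> * (l \<zeta>0 + \<rho>\<^sup>2 / 4) > 0" using \<eta>(1) \<rho>(1) by (simp add: l_def)
  ultimately show False unfolding g using \<zeta>0 by (simp add: E_def)
qed

text \<open>The maximum principle above is applied to \<open>f - h\<close>: on a disc so small that
  its slice stays in \<open>W\<close>, \<open>f\<close> is tested against \<open>h\<close> plus an
  affine function, which is again harmonic.\<close>

lemma psh_real_local:
  assumes "open U" and loc: "\<And>z. z \<in> U \<Longrightarrow> \<exists>W. z \<in> W \<and> W \<subseteq> U \<and> psh_real W f"
  shows "psh_real U f"
proof (rule psh_realI)
  have "\<forall>z\<in>U. isCont f z"
    using loc by (meson continuous_on_eq_continuous_at psh_real_continuous psh_real_open)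
  thus cont: "continuous_on U f" by (simp add: continuous_at_imp_continuous_on)
  fix a b c r h \<zeta>
  assume *: "\<And>\<zeta>. \<zeta> \<in> cball c r \<Longrightarrow> a + \<zeta> *s b \<in> U" "continuous_on (cball c r) h"
    "harmonic_on_ball c r h" "\<And>\<zeta>. \<zeta> \<in> sphere c r \<Longrightarrow> f (a + \<zeta> *s b) \<le> h \<zeta>"
    "\<zeta> \<in> cball c r"
  have "f (a + \<zeta> *s b) - h \<zeta> \<le> 0"
  proof (rule nonpos_of_local_linear_majorant[where \<phi> = "\<lambda>\<zeta>. f (a + \<zeta> *s b) - h \<zeta>", OF _ _ _ *(5)])
    show "continuous_on (cball c r) (\<lambda>\<zeta>. f (a + \<zeta> *s b) - h \<zeta>)"
      by (intro continuous_intros *(2) continuous_on_compose2[OF cont] continuous_on_slice)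
         (use *(1) in auto)
    fix \<zeta>0 assume \<zeta>0: "\<zeta>0 \<in> ball c r"
    then obtain W where W: "a + \<zeta>0 *s b \<in> W" "psh_real W f"
      using loc *(1) by (meson ball_subset_cball subsetD)
    have "open ((\<lambda>\<zeta>. a + \<zeta> *s b) -` W)"
      by (rule open_vimage[OF psh_real_open[OF W(2)] continuous_on_slice])
    hence "open (ball c r \<inter> (\<lambda>\<zeta>. a + \<zeta> *s b) -` W)" by blast
    then obtain \<rho> where \<rho>: "\<rho> > 0" "cball \<zeta>0 \<rho> \<subseteq> ball c r \<inter> (\<lambda>\<zeta>. a + \<zeta> *s b) -` W"
      using \<zeta>0 W(1) by (metis IntI open_contains_cball vimageI)
    have sub: "ball \<zeta>0 \<rho> \<subseteq> ball c r" "cball \<zeta>0 \<rho> \<subseteq> cball c r"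
      using \<rho>(2) ball_subset_cball by blast+
    show "\<exists>\<rho>>0. cball \<zeta>0 \<rho> \<subseteq> ball c r \<and> (\<forall>m d. (\<forall>\<zeta>\<in>sphere \<zeta>0 \<rho>.
        f (a + \<zeta> *s b) - h \<zeta> \<le> Re (m * \<zeta>) + d) \<longrightarrow> f (a + \<zeta>0 *s b) - h \<zeta>0 \<le> Re (m * \<zeta>0) + d)"
    proof (intro exI[of _ \<rho>] conjI allI impI \<rho>(1))
      fix m d assume maj: "\<forall>\<zeta>\<in>sphere \<zeta>0 \<rho>. f (a + \<zeta> *s b) - h \<zeta> \<le> Re (m * \<zeta>) + d"
      have "f (a + \<zeta>0 *s b) \<le> 1 * h \<zeta>0 + Re (m * \<zeta>0) + d"
      proof (rule psh_realD[OF W(2), where c = \<zeta>0 and r = \<rho>])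
        show "continuous_on (cball \<zeta>0 \<rho>) (\<lambda>\<zeta>. 1 * h \<zeta> + Re (m * \<zeta>) + d)"
          using continuous_on_subset[OF *(2) sub(2)] by (intro continuous_intros)
        show "harmonic_on_ball \<zeta>0 \<rho> (\<lambda>\<zeta>. 1 * h \<zeta> + Re (m * \<zeta>) + d)"
          by (intro harmonic_on_ball_affine harmonic_on_ball_subset[OF *(3) sub(1)]) simp
      qed (use \<rho> maj in \<open>auto simp: algebra_simps\<close>)
      thus "f (a + \<zeta>0 *s b) - h \<zeta>0 \<le> Re (m * \<zeta>0) + d" by simp
    qed (use \<rho> in auto)
  qed (use *(4) in auto)
  thus "f (a + \<zeta> *s b) \<le> h \<zeta>" by simp
qed (rule assms)

text \<open>\<open>h\<close> is the real part of a holomorphic function only in the open disc. The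
  holomorphic maximum principle is therefore used on small closed discs inside it, and
  \<open>nonpos_of_local_linear_majorant\<close> carries the estimate to the whole disc.\<close>

lemma psh_real_const:
  assumes "open U"
  shows "psh_real U (\<lambda>_. d)"
proof (rule psh_realI)
  fix a b :: "complex^'n" and c r h \<zeta>
  assume *: "continuous_on (cball c r) h" "harmonic_on_ball c r h"
    "\<And>\<zeta>. \<zeta> \<in> sphere c r \<Longrightarrow> d \<le> h \<zeta>" "\<zeta> \<in> cball c r"
  obtain F where F: "F holomorphic_on ball c r" "\<forall>\<zeta>\<in>ball c r. h \<zeta> = Re (F \<zeta>)"
    using *(2) unfolding harmonic_on_ball_def by blast
  have "d - h \<zeta> \<le> 0"
  proof (rule nonpos_of_local_linear_majorant[where \<phi> = "\<lambda>\<zeta>. d - h \<zeta>", OF _ _ _ *(4)])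
    fix \<zeta>0 assume \<zeta>0: "\<zeta>0 \<in> ball c r"
    then obtain \<rho> where \<rho>: "\<rho> > 0" "cball \<zeta>0 \<rho> \<subseteq> ball c r"
      using open_contains_cball by blast
    show "\<exists>\<rho>>0. cball \<zeta>0 \<rho> \<subseteq> ball c r \<and> (\<forall>m e. (\<forall>\<zeta>\<in>sphere \<zeta>0 \<rho>. d - h \<zeta> \<le> Re (m * \<zeta>) + e) \<longrightarrow>
        d - h \<zeta>0 \<le> Re (m * \<zeta>0) + e)"
    proof (intro exI[of _ \<rho>] conjI allI impI \<rho>)
      fix m e assume maj: "\<forall>\<zeta>\<in>sphere \<zeta>0 \<rho>. d - h \<zeta> \<le> Re (m * \<zeta>) + e"
      define G where "G w = - (F w + m * w + of_real e)" for w
      have G: "G holomorphic_on cball \<zeta>0 \<rho>" unfolding G_def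
        using holomorphic_on_subset[OF F(1) \<rho>(2)] by (intro holomorphic_intros)
      have ReG: "Re (G w) = - (h w + Re (m * w) + e)" if "w \<in> cball \<zeta>0 \<rho>" for w
        using that F(2) \<rho>(2) by (auto simp: G_def)
      have "Re (G \<zeta>0) \<le> - d"
      proof (rule maximum_real_frontier[of G "cball \<zeta>0 \<rho>"])
        show "G holomorphic_on interior (cball \<zeta>0 \<rho>)"
          using G holomorphic_on_subset interior_subset by blast
        show "continuous_on (closure (cball \<zeta>0 \<rho>)) G"
          using G holomorphic_on_imp_continuous_on by auto
        show "Re (G w) \<le> - d" if "w \<in> frontier (cball \<zeta>0 \<rho>)" for w
        proof -
          have w: "w \<in> sphere \<zeta>0 \<rho>" using that \<rho>(1) by simp
          thus ?thesis using maj ReG[of w] by fastforce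
        qed
      qed (use \<rho> in auto)
      thus "d - h \<zeta>0 \<le> Re (m * \<zeta>0) + e" using ReG[of \<zeta>0] \<rho>(1) by simp
    qed
  qed (use * in \<open>auto intro!: continuous_intros\<close>)
  thus "d \<le> h \<zeta>" by simp
qed (use assms in auto)

text \<open>The new function is \<open>max f g\<close> on the open set \<open>B\<close> and equals
  \<open>f\<close> near every other point of \<open>U\<close>, because \<open>g\<close> does not
  exceed \<open>f\<close> there; plurisubharmonicity is local.\<close>

lemma psh_real_glue:
  assumes f: "psh_real U f" and g: "psh_real B g" and "B \<subseteq> U"
    and near: "\<And>z. z \<in> U - B \<Longrightarrow> \<exists>W. open W \<and> z \<in> W \<and> (\<forall>w\<in>W \<inter> B. g w \<le> f w)"
  shows "psh_real U (\<lambda>z. if z \<in> B then max (f z) (g z) else f z)" (is "psh_real U ?F")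
proof (rule psh_real_local)
  show "open U" using f psh_real_open by blast
  fix z assume z: "z \<in> U"
  show "\<exists>W. z \<in> W \<and> W \<subseteq> U \<and> psh_real W ?F"
  proof (cases "z \<in> B")
    case True
    have "psh_real B (\<lambda>z. max (f z) (g z))"
      using psh_real_subset[OF f psh_real_open[OF g] \<open>B \<subseteq> U\<close>] g by (rule psh_real_max)
    hence "psh_real B ?F" by (rule psh_real_cong) auto
    thus ?thesis using True \<open>B \<subseteq> U\<close> by blast
  next
    case False
    then obtain W where W: "open W" "z \<in> W" "\<forall>w\<in>W \<inter> B. g w \<le> f w"
      using near z by auto
    have "psh_real (W \<inter> U) f"
      using psh_real_subset[OF f, of "W \<inter> U"] W(1) psh_real_open[OF f] by blast
    hence "psh_real (W \<inter> U) ?F" by (rule psh_real_cong) (use W(3) in auto)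
    thus ?thesis using W(2) z by blast
  qed
qed

section \<open>Passage between \<open>psh_on\<close> and \<open>psh_real\<close>\<close>

lemma psh_real_of_psh_on:
  assumes "psh_on U (\<lambda>z. ereal (f z))" "continuous_on U f"
  shows "psh_real U f"
proof (rule psh_realI)
  show "open U" using assms by (simp add: psh_on_def)
  fix a b c r h \<zeta>
  assume *: "\<And>\<zeta>. \<zeta> \<in> cball c r \<Longrightarrow> a + \<zeta> *s b \<in> U" "continuous_on (cball c r) h"
    "harmonic_on_ball c r h" "\<And>\<zeta>. \<zeta> \<in> sphere c r \<Longrightarrow> f (a + \<zeta> *s b) \<le> h \<zeta>" "\<zeta> \<in> cball c r"
  have "subharmonic_on {\<zeta>. a + \<zeta> *s b \<in> U} (\<lambda>\<zeta>. ereal (f (a + \<zeta> *s b)))"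
    using assms(1) by (simp add: psh_on_def)
  moreover have "cball c r \<subseteq> {\<zeta>. a + \<zeta> *s b \<in> U}" using *(1) by auto
  moreover have "\<forall>\<zeta>\<in>sphere c r. ereal (f (a + \<zeta> *s b)) \<le> ereal (h \<zeta>)" using *(4) by simp
  ultimately have "\<forall>\<zeta>\<in>cball c r. ereal (f (a + \<zeta> *s b)) \<le> ereal (h \<zeta>)"
    using *(2,3) unfolding subharmonic_on_def by blast
  thus "f (a + \<zeta> *s b) \<le> h \<zeta>" using *(5) by simp
qed (rule assms)

lemma usc_on_continuous:
  assumes "open U" "continuous_on U f"
  shows "usc_on U (\<lambda>z. ereal (f z))"
  unfolding usc_on_def
proof
  fix c
  have "{x \<in> U. ereal (f x) < ereal c} = U \<inter> f -` {..<c}" by auto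
  moreover have "openin (top_of_set U) (U \<inter> f -` {..<c})"
    by (rule continuous_openin_preimage_gen[OF assms(2)]) simp
  ultimately show "openin (top_of_set U) {x \<in> U. ereal (f x) < ereal c}" by simp
qed

lemma psh_on_of_psh_real:
  assumes f: "psh_real U f"
  shows "psh_on U (\<lambda>z. ereal (f z))"
  unfolding psh_on_def subharmonic_on_def
proof (intro conjI allI)
  note U = psh_real_open[OF f] and cont = psh_real_continuous[OF f]
  show "open U" "usc_on U (\<lambda>z. ereal (f z))" using usc_on_continuous[OF U cont] U by auto
  fix a b
  show 1: "open {\<zeta>. a + \<zeta> *s b \<in> U}"
    using open_vimage[OF U continuous_on_slice] by (simp add: vimage_def)
  show "usc_on {\<zeta>. a + \<zeta> *s b \<in> U} (\<lambda>\<zeta>. ereal (f (a + \<zeta> *s b)))"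
    by (intro usc_on_continuous 1 continuous_on_compose2[OF cont] continuous_on_slice) auto
next
  fix a b c r h
  show "cball c r \<subseteq> {\<zeta>. a + \<zeta> *s b \<in> U} \<longrightarrow> continuous_on (cball c r) h \<longrightarrow> harmonic_on_ball c r h \<longrightarrow>
     (\<forall>\<zeta>\<in>sphere c r. ereal (f (a + \<zeta> *s b)) \<le> ereal (h \<zeta>)) \<longrightarrow>
     (\<forall>\<zeta>\<in>cball c r. ereal (f (a + \<zeta> *s b)) \<le> ereal (h \<zeta>))"
  proof (intro impI ballI)
    fix \<zeta>
    assume *: "cball c r \<subseteq> {\<zeta>. a + \<zeta> *s b \<in> U}" "continuous_on (cball c r) h"
      "harmonic_on_ball c r h" "\<forall>\<zeta>\<in>sphere c r. ereal (f (a + \<zeta> *s b)) \<le> ereal (h \<zeta>)" "\<zeta> \<in> cball c r"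
    have "f (a + \<zeta> *s b) \<le> h \<zeta>"
      by (rule psh_realD[OF f _ *(2,3) _ *(5)]) (use *(1,4) in auto)
    thus "ereal (f (a + \<zeta> *s b)) \<le> ereal (h \<zeta>)" by simp
  qed
qed auto

section \<open>Geometry of Hoelder charts\<close>

lemma bounded_frontier_nonempty:
  fixes \<Omega> :: "(complex^'n) set"
  assumes "bounded \<Omega>" "\<Omega> \<noteq> {}"
  shows "frontier \<Omega> \<noteq> {}"
proof -
  have "\<Omega> \<noteq> UNIV" using assms(1) not_bounded_UNIV by blast
  thus ?thesis using assms(2) by (simp add: frontier_eq_empty)
qed

lemma bdist_pos:
  fixes \<Omega> :: "(complex^'n) set"
  assumes "open \<Omega>" "frontier \<Omega> \<noteq> {}" "z \<in> \<Omega>"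
  shows "bdist \<Omega> z > 0"
  unfolding bdist_def
  by (rule infdist_pos_not_in_closed) (use assms in \<open>auto simp: frontier_def interior_open\<close>)

lemma bdist_geI:
  assumes "open \<Omega>" "frontier \<Omega> \<noteq> {}" "\<And>y. y \<notin> \<Omega> \<Longrightarrow> e \<le> dist z y"
  shows "e \<le> bdist \<Omega> z"
proof -
  have "e \<le> dist z y" if "y \<in> frontier \<Omega>" for y
    using that assms(1,3) by (auto simp: frontier_def interior_open)
  thus ?thesis unfolding bdist_def infdist_notempty[OF assms(2)]
    by (intro cINF_greatest assms(2))
qed

lemma bdist_lipschitz: "bdist \<Omega> z \<le> bdist \<Omega> w + dist z w"
  unfolding bdist_def by (rule infdist_triangle)

lemma continuous_on_bdist: "continuous_on S (bdist \<Omega>)"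
  unfolding bdist_def[abs_def] by (intro continuous_on_infdist continuous_on_id)

lemma hproj_eq: "hproj v w = w - (w \<bullet> v) *\<^sub>R v"
  by (simp add: hproj_def Re_cinner)

lemma hproj_shift:
  assumes "norm v = 1"
  shows "hproj v (w + s *\<^sub>R v) = hproj v w"
  using assms by (simp add: hproj_eq inner_add_left algebra_simps norm_eq_1)

lemma norm_hproj_le:
  assumes "norm v = 1"
  shows "norm (hproj v w) \<le> norm w"
proof (rule power2_le_imp_le)
  have "(norm (hproj v w))\<^sup>2 = (norm w)\<^sup>2 - (w \<bullet> v)\<^sup>2"
    using assms unfolding power2_norm_eq_inner hproj_eq norm_eq_1
    by (simp add: inner_diff_left inner_diff_right inner_commute power2_eq_square)
  thus "(norm (hproj v w))\<^sup>2 \<le> (norm w)\<^sup>2" by simp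
qed simp

lemma hproj_diff: "hproj v x - hproj v y = hproj v (x - y)"
  by (simp add: hproj_eq inner_diff_left algebra_simps)

text \<open>The shift gains height \<open>s\<close>, while a displacement below \<open>s ^ q\<close>
  changes the graph by at most \<open>C * (s ^ q) powr a \<le> C * s\<^sup>2\<close>. A point
  \<open>y\<close> outside and closer than \<open>s ^ q\<close> would force
  \<open>s < (C + 1) * s\<^sup>2\<close>, against the smallness of \<open>s\<close>. The bounds by
  \<open>r/4\<close> keep all points involved in \<open>V\<close>.\<close>

lemma holder_chart_shift:
  fixes \<Omega> V :: "(complex^'n) set"
  assumes chart: "\<Omega> \<inter> V = {w\<in>V. Re (cinner (w - p) v) > h (hproj v (w - p))}"
    and v: "norm v = 1" and V': "\<And>w. w \<in> V \<Longrightarrow> hproj v (w - p) \<in> V'"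
    and holder: "\<And>x y. x \<in> V' \<Longrightarrow> y \<in> V' \<Longrightarrow> \<bar>h x - h y\<bar> \<le> C * dist x y powr a"
    and a: "0 < a" "a \<le> 1" and q: "real q * a \<ge> 2" and C: "C \<ge> 0"
    and ball: "ball x r \<subseteq> V" and z: "z \<in> \<Omega> \<inter> ball x (r/4)"
    and s: "0 < s" "s < r/4" "s < 1" "(C + 1) * s < 1"
  shows "z + s *\<^sub>R v \<in> \<Omega>" "y \<notin> \<Omega> \<Longrightarrow> s ^ q \<le> dist (z + s *\<^sub>R v) y"
proof -
  let ?z = "z + s *\<^sub>R v"
  have dz: "dist z ?z = s" using v s by (simp add: dist_norm)
  have vv: "v \<bullet> v = 1" using v by (simp add: norm_eq_1)
  have zV: "z \<in> V" using z ball s by auto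
  have "?z \<in> ball x r" using z dz s dist_triangle[of x ?z z] by simp
  hence z'V: "?z \<in> V" using ball by blast
  have mem: "w \<in> \<Omega> \<longleftrightarrow> (w - p) \<bullet> v > h (hproj v (w - p))" if "w \<in> V" for w
    using that eqset_imp_iff[OF chart, of w] by (simp add: Re_cinner)
  have hz: "(z - p) \<bullet> v > h (hproj v (z - p))"
    using z mem[OF zV] by blast
  have shift: "?z - p = (z - p) + s *\<^sub>R v" by simp
  have "(?z - p) \<bullet> v > h (hproj v (?z - p))"
    unfolding shift hproj_shift[OF v] using hz s vv by (simp add: inner_add_left)
  thus "?z \<in> \<Omega>" using mem[OF z'V] by blast
  assume y: "y \<notin> \<Omega>"
  show "s ^ q \<le> dist ?z y"
  proof (rule ccontr)
    define d where "d = dist ?z y"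
    assume "\<not> s ^ q \<le> dist ?z y"
    hence d: "d < s ^ q" by (simp add: d_def)
    have "real q * a \<le> real q * 1" using a by (intro mult_left_mono) auto
    hence q2: "q \<ge> 2" using q by linarith
    have sq: "s ^ q \<le> s ^ 2" using s q2 by (intro power_decreasing) auto
    have "s ^ 2 \<le> s" using s by (simp add: power2_eq_square mult_le_cancel_left1)
    hence "d < r/4" using d sq s by linarith
    hence "y \<in> ball x r"
      using z dz s dist_triangle[of x y z] dist_triangle[of z y ?z] by (simp add: d_def)
    hence yV: "y \<in> V" using ball by blast
    have hy: "(y - p) \<bullet> v \<le> h (hproj v (y - p))"
      using y mem[OF yV] by linarith
    have "(z - p) \<bullet> v + s - (y - p) \<bullet> v = (?z - y) \<bullet> v"
      using vv by (simp add: inner_diff_left inner_add_left)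
    also have "\<dots> \<le> d" using norm_cauchy_schwarz[of "?z - y" v] v by (simp add: d_def dist_norm)
    finally have 1: "s < h (hproj v (y - p)) - h (hproj v (z - p)) + d" using hz hy by linarith
    have "norm (hproj v (?z - y)) \<le> d"
      using norm_hproj_le[OF v] by (simp add: d_def dist_norm)
    moreover have "hproj v (?z - y) = hproj v (z - p) - hproj v (y - p)"
      unfolding hproj_diff using hproj_shift[OF v, of "z - y" s] by (simp add: algebra_simps)
    ultimately have pd: "dist (hproj v (y - p)) (hproj v (z - p)) \<le> d"
      by (simp add: dist_norm norm_minus_commute)
    have "dist (hproj v (y - p)) (hproj v (z - p)) powr a \<le> (s ^ q) powr a"
      using pd d a by (intro powr_mono2) auto
    also have "\<dots> = s powr (real q * a)"
      using s by (simp add: powr_powr flip: powr_realpow)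
    also have "\<dots> \<le> s powr 2" using s q by (intro powr_mono') auto
    also have "\<dots> = s ^ 2" using s powr_realpow[of s 2] by simp
    finally have "C * dist (hproj v (y - p)) (hproj v (z - p)) powr a \<le> C * s ^ 2"
      using C by (rule mult_left_mono)
    hence "h (hproj v (y - p)) - h (hproj v (z - p)) \<le> C * s ^ 2"
      using holder[OF V'[OF yV] V'[OF zV]] by linarith
    hence "s < (C + 1) * s ^ 2" using 1 d sq by (simp add: algebra_simps)
    also have "\<dots> < 1 * s" unfolding power2_eq_square mult.assoc[symmetric]
      using s by (intro mult_strict_right_mono) auto
    finally show False by simp
  qed
qed

text \<open>Compactness makes the chart estimate uniform: a Lebesgue number of the cover gives the
  radius, and the finitely many Hoelder constants and exponents are replaced by common ones. Only
  the direction \<open>v\<close> depends on \<open>x\<close>.\<close>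

lemma holder_domain_shift:
  fixes \<Omega> :: "(complex^'n) set"
  assumes "holder_domain \<Omega>"
  obtains r s0 :: real and q :: nat where "0 < r" "0 < s0"
    "\<And>x. x \<in> frontier \<Omega> \<Longrightarrow> \<exists>v. norm v = 1 \<and> (\<forall>z\<in>\<Omega> \<inter> ball x r. \<forall>s. 0 < s \<and> s < s0 \<longrightarrow>
        z + s *\<^sub>R v \<in> \<Omega> \<and> s ^ q \<le> bdist \<Omega> (z + s *\<^sub>R v))"
proof -
  obtain J :: "nat set" and V p v V' h a where \<Omega>: "bounded \<Omega>" "open \<Omega>" "\<Omega> \<noteq> {}"
    and J: "finite J" "frontier \<Omega> \<subseteq> (\<Union>j\<in>J. V j)"
    and j: "\<forall>j\<in>J. open (V j) \<and> p j \<in> V j \<and> norm (v j) = 1 \<and>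
         V' j \<subseteq> {w. Re (cinner w (v j)) = 0} \<and>
         openin (top_of_set {w. Re (cinner w (v j)) = 0}) (V' j) \<and> 0 \<in> V' j \<and>
         (\<forall>w\<in>V j. hproj (v j) (w - p j) \<in> V' j) \<and>
         0 < a j \<and> a j \<le> 1 \<and> holder_on (a j) (V' j) (h j) \<and> h j 0 = 0 \<and>
         \<Omega> \<inter> V j = {w\<in>V j. Re (cinner (w - p j) (v j)) > h j (hproj (v j) (w - p j))}"
    using assms unfolding holder_domain_def by (elim conjE exE) (rule that)
  have "\<exists>C. \<forall>j\<in>J. \<forall>x\<in>V' j. \<forall>y\<in>V' j. \<bar>h j x - h j y\<bar> \<le> C j * dist x y powr a j"
    using j unfolding holder_on_def by (intro bchoice) blast
  then obtain C where C: "\<And>j x y. j \<in> J \<Longrightarrow> x \<in> V' j \<Longrightarrow> y \<in> V' j \<Longrightarrow>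
      \<bar>h j x - h j y\<bar> \<le> C j * dist x y powr a j" by blast
  define C0 where "C0 = (\<Sum>j\<in>J. \<bar>C j\<bar>)"
  have C0: "C0 \<ge> 0" "C j \<le> C0" if "j \<in> J" for j
    using member_le_sum[OF that, of "\<lambda>j. \<bar>C j\<bar>"] J(1) by (auto simp: C0_def sum_nonneg)
  have C0': "C0 \<ge> 0" by (auto simp: C0_def sum_nonneg)
  define q where "q = (\<Sum>j\<in>J. nat \<lceil>2 / a j\<rceil>)"
  have q: "real q * a j \<ge> 2" if "j \<in> J" for j
  proof -
    have "nat \<lceil>2 / a j\<rceil> \<le> q" unfolding q_def by (rule member_le_sum[OF that]) (use J in auto)
    hence "2 / a j \<le> real q" by linarith
    thus ?thesis using j that by (simp add: field_simps)
  qed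
  have "compact (frontier \<Omega>)" using \<Omega> by (simp add: compact_frontier_bounded)
  moreover have "\<And>G. G \<in> V ` J \<Longrightarrow> open G" using j by blast
  ultimately obtain r where r: "r > 0" "\<And>x. x \<in> frontier \<Omega> \<Longrightarrow> \<exists>G\<in>V ` J. ball x r \<subseteq> G"
    using Heine_Borel_lemma[of "frontier \<Omega>" "V ` J"] J(2) by blast
  \<comment> \<open>The three bounds keep shifted points in the chart, make powers of
    \<open>s\<close> decrease with the exponent, and give \<open>(C0 + 1) * s < 1\<close>.\<close>
  define s0 where "s0 = min (r/4) (min 1 (1 / (C0 + 1)))"
  have ne: "frontier \<Omega> \<noteq> {}" by (rule bounded_frontier_nonempty) (use \<Omega> in auto)
  show thesis
  proof (rule that[of "r/4" s0 q])
    show "0 < r/4" "0 < s0" using r C0' by (auto simp: s0_def)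
    fix x assume x: "x \<in> frontier \<Omega>"
    then obtain i where i: "i \<in> J" "ball x r \<subseteq> V i" using r(2)[OF x] by blast
    note ji = j[rule_format, OF i(1)]
    have hol: "\<bar>h i x - h i y\<bar> \<le> C0 * dist x y powr a i" if "x \<in> V' i" "y \<in> V' i" for x y
      using C[OF i(1) that] mult_right_mono[OF C0(2)[OF i(1)], of "dist x y powr a i"] by auto
    show "\<exists>v. norm v = 1 \<and> (\<forall>z\<in>\<Omega> \<inter> ball x (r/4). \<forall>s. 0 < s \<and> s < s0 \<longrightarrow>
        z + s *\<^sub>R v \<in> \<Omega> \<and> s ^ q \<le> bdist \<Omega> (z + s *\<^sub>R v))"
    proof (intro exI[of _ "v i"] conjI ballI allI impI)
      fix z s assume z: "z \<in> \<Omega> \<inter> ball x (r/4)" and "0 < s \<and> s < s0"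
      hence s: "0 < s" "s < r/4" "s < 1" and "s < 1 / (C0 + 1)" by (auto simp: s0_def)
      hence s': "(C0 + 1) * s < 1" using C0' by (simp add: field_simps)
      note * = holder_chart_shift[where \<Omega> = \<Omega> and V = "V i" and p = "p i" and v = "v i" and h = "h i"
          and V' = "V' i" and C = C0 and a = "a i" and q = q and x = x and r = r and z = z and s = s,
          OF _ _ _ hol _ _ q[OF i(1)] C0' _ z s s']
      show "z + s *\<^sub>R v i \<in> \<Omega>" by (rule *(1)) (use ji i(2) in auto)
      show "s ^ q \<le> bdist \<Omega> (z + s *\<^sub>R v i)"
        by (intro bdist_geI \<Omega> ne *(2)) (use ji i(2) in auto)
    qed (use ji in auto)
  qed
qed

section \<open>Local barriers\<close>

text \<open>Counting starts at index 1: the scale \<open>t 0\<close> only marks where the first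
  glueing takes place.\<close>

definition level :: "(nat \<Rightarrow> real) \<Rightarrow> nat \<Rightarrow> real \<Rightarrow> nat" where
  "level t k d = card {i\<in>{1..k}. d < t i}"

lemma level_0 [simp]: "level t 0 d = 0"
  by (simp add: level_def)

lemma level_Suc: "level t (Suc k) d = level t k d + (if d < t (Suc k) then 1 else 0)"
proof -
  have "{i\<in>{1..Suc k}. d < t i} = {i\<in>{1..k}. d < t i} \<union> (if d < t (Suc k) then {Suc k} else {})"
    by (auto simp: le_Suc_eq)
  thus ?thesis by (simp add: level_def)
qed

lemma level_le: "level t k d \<le> k"
  by (induction k) (auto simp: level_Suc)

lemma level_eq:
  assumes "decseq t" "d < t k"
  shows "level t k d = k"
proof -
  have "{i\<in>{1..k}. d < t i} = {1..k}"
    using assms by (auto dest: decseqD[of t _ k])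
  thus ?thesis by (simp add: level_def)
qed

lemma level_le_index:
  assumes "decseq t" "t i \<le> d"
  shows "level t k d \<le> i"
proof -
  have "{j\<in>{1..k}. d < t j} \<subseteq> {1..<Suc i}"
  proof
    fix j assume j: "j \<in> {j\<in>{1..k}. d < t j}"
    hence "\<not> i \<le> j" using decseqD[OF assms(1), of i j] assms(2) by fastforce
    thus "j \<in> {1..<Suc i}" using j by simp
  qed
  from card_mono[OF _ this] show ?thesis by (simp add: level_def)
qed

text \<open>Logarithms of consecutive scales differ by the factor 8. In \<open>local_barrier\<close>
  this keeps \<open>V s / R\<close> at most \<open>1 / (8 * q)\<close> where
  \<open>\<delta> > t / 2\<close>, half of the value \<open>1 / (4 * q)\<close> that it reaches at
  least where \<open>\<delta> < s\<close>.\<close>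

definition bscale :: "real \<Rightarrow> nat \<Rightarrow> real" where
  "bscale t0 k = t0 ^ (8 ^ k)"

lemma bscale_Suc: "bscale t0 (Suc k) = bscale t0 k ^ 8"
  unfolding bscale_def power_Suc2 power_mult ..

lemma bscale_bounds:
  assumes "0 < t0" "t0 \<le> 1/4"
  shows "0 < bscale t0 k" "bscale t0 k \<le> 1/4" "bscale t0 k \<le> t0"
proof -
  have "t0 ^ (8 ^ k) \<le> t0 ^ 1" using assms by (intro power_decreasing) auto
  thus "bscale t0 k \<le> t0" by (simp add: bscale_def)
  thus "bscale t0 k \<le> 1/4" using assms(2) by linarith
  show "0 < bscale t0 k" using assms(1) by (simp add: bscale_def)
qed

text \<open>For consecutive scales \<open>t\<close> and \<open>s\<close>, the factor 4 leaves
  \<open>\<delta> - s > t / 4\<close> where \<open>\<delta> > t / 2\<close>.\<close>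

lemma bscale_step:
  assumes "0 < t0" "t0 \<le> 1/4"
  shows "bscale t0 (Suc k) \<le> bscale t0 k / 4"
proof -
  note b = bscale_bounds[OF assms, of k]
  have "bscale t0 k ^ 8 \<le> bscale t0 k ^ 2" using b by (intro power_decreasing) auto
  also have "\<dots> \<le> bscale t0 k * (1/4)" unfolding power2_eq_square using b by (intro mult_left_mono) auto
  finally show ?thesis by (simp add: bscale_Suc)
qed

lemma decseq_bscale:
  assumes "0 < t0" "t0 \<le> 1/4"
  shows "decseq (bscale t0)"
proof (rule decseq_SucI)
  show "bscale t0 (Suc k) \<le> bscale t0 k" for k
    using bscale_step[OF assms, of k] bscale_bounds(1)[OF assms, of k] by linarith
qed

lemma bscale_tendsto_0:
  assumes "0 < t0" "t0 \<le> 1/4"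
  shows "bscale t0 \<longlonglongrightarrow> 0"
proof (rule real_tendsto_sandwich[of "\<lambda>_. 0" _ _ "\<lambda>k. (1/4) ^ k"])
  have "bscale t0 k \<le> (1/4) ^ k" for k
  proof (induction k)
    case 0 show ?case using bscale_bounds(2)[OF assms, of 0] by simp
  next
    case (Suc k) thus ?case using bscale_step[OF assms, of k] by simp
  qed
  thus "\<forall>\<^sub>F k in sequentially. bscale t0 k \<le> (1/4) ^ k" by (intro always_eventually allI)
  show "\<forall>\<^sub>F k in sequentially. 0 \<le> bscale t0 k"
    using bscale_bounds(1)[OF assms] by (intro always_eventually allI less_imp_le)
  show "(\<lambda>k. (1/4::real) ^ k) \<longlonglongrightarrow> 0" by (rule LIMSEQ_realpow_zero) auto
qed (rule tendsto_const)

text \<open>On \<open>\<delta> < t\<^sub>k\<close> the previous barrier is raised to \<open>\<theta> ^ k / \<theta> * (V s / (2 q ln (1/s)) - 1)\<close>,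
  where \<open>s = t\<^sub>k ^ 8\<close>. The bracket is at least \<open>- \<theta>\<^sup>2\<close> where \<open>\<delta> < s\<close>, and at most \<open>- \<theta>\<close> near
  \<open>\<delta> = t\<^sub>k\<close>, so that the glueing does not change the old barrier there.\<close>

lemma local_barrier:
  fixes D :: "(complex^'n) set" and \<delta> :: "complex^'n \<Rightarrow> real" and q :: nat
  assumes D: "open D" and \<delta>: "continuous_on D \<delta>" and t0: "0 < t0" "t0 \<le> 1/4" and "q \<ge> 1"
    and psh: "\<And>s. 0 < s \<Longrightarrow> s \<le> t0 \<Longrightarrow> psh_real D (V s)"
    and ub: "\<And>s z. 0 < s \<Longrightarrow> s \<le> t0 \<Longrightarrow> z \<in> D \<Longrightarrow> V s z \<le> q * ln (1/s)"
    and lb: "\<And>s z. 0 < s \<Longrightarrow> s \<le> t0 \<Longrightarrow> z \<in> D \<Longrightarrow> V s z \<ge> - ln (\<delta> z + s)"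
    and ub': "\<And>s z. 0 < s \<Longrightarrow> s \<le> t0 \<Longrightarrow> z \<in> D \<Longrightarrow> s < \<delta> z \<Longrightarrow> V s z \<le> - ln (\<delta> z - s)"
    and pos: "\<And>z. z \<in> D \<Longrightarrow> \<delta> z > 0"
    and \<theta>: "\<theta> = 1 - 1 / (8 * real q)"
  shows "\<exists>f. psh_real D f \<and> (\<forall>z\<in>D. - (\<theta> ^ level (bscale t0) k (\<delta> z)) \<le> f z \<and>
           f z \<le> - (\<theta> ^ level (bscale t0) k (\<delta> z) / 2))"
proof (induction k)
  case 0
  show ?case using psh_real_const[OF D, of "-1"] by (intro exI[of _ "\<lambda>_. -1"]) auto
next
  case (Suc k)
  let ?L = "\<lambda>k z. level (bscale t0) k (\<delta> z)"
  obtain f where f: "psh_real D f" "\<And>z. z \<in> D \<Longrightarrow> - (\<theta> ^ ?L k z) \<le> f z"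
    "\<And>z. z \<in> D \<Longrightarrow> f z \<le> - (\<theta> ^ ?L k z / 2)"
    using Suc by blast
  have x: "0 < 1 / (8 * real q)" "1 / (8 * real q) \<le> 1/8" using \<open>q \<ge> 1\<close> by (auto simp: field_simps)
  have \<theta>01: "0 < \<theta>" "\<theta> < 1" using x \<theta> by auto
  \<comment> \<open>The left side is one minus the lower bound of \<open>V s / R\<close> below
    \<open>s\<close>. Comparing it with \<open>\<theta>\<^sup>2\<close> gains one factor
    \<open>\<theta>\<close> after the division by \<open>\<theta>\<close> in
    \<open>g\<close>.\<close>
  have \<theta>2: "1 - 2 * (1 / (8 * real q)) \<le> \<theta>\<^sup>2" unfolding \<theta> power2_eq_square
    by (simp add: algebra_simps)
  define t where "t = bscale t0 k"
  define s where "s = bscale t0 (Suc k)"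
  note b = bscale_bounds[OF t0]
  have st: "0 < t" "t \<le> 1/4" "0 < s" "s \<le> t0" "s \<le> t/4" "s \<le> 1/4" "t \<le> t0"
    using b[of k] b[of "Suc k"] bscale_step[OF t0, of k] unfolding t_def s_def
    by auto
  have s8: "s = t ^ 8" by (simp add: s_def t_def bscale_Suc)
  \<comment> \<open>Twice the upper bound of \<open>V s\<close>, so that \<open>g\<close> never
    exceeds \<open>- (\<theta> ^ k / 2)\<close> and the upper bound on the barrier survives the
    maximum.\<close>
  define R where "R = 2 * real q * ln (1/s)"
  have lns: "ln (1/s) = 8 * ln (1/t)" using st(1) unfolding s8 by (simp add: ln_div ln_realpow)
  have lnt: "ln (1/t) \<ge> ln 4" using st(1,2) by (intro ln_mono) (auto simp: field_simps)
  have ln4: "ln (4::real) > 0" by simp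
  have lns4: "ln (1/s) \<ge> ln 4" using lns lnt ln4 by linarith
  have "ln (1/s) > 0" using lns4 ln4 by (rule less_le_trans[rotated])
  hence R: "R > 0" unfolding R_def using \<open>q \<ge> 1\<close> by simp
  define g where "g z = \<theta> ^ k / \<theta> * (V s z / R - 1)" for z
  have g_psh: "psh_real D g"
  proof -
    have "psh_real D (\<lambda>z. (\<theta> ^ k / \<theta> / R) * V s z + z \<bullet> 0 + (- (\<theta> ^ k / \<theta>)))"
      using psh[OF st(3,4)] \<theta>01 R by (intro psh_real_affine) auto
    thus ?thesis by (rule psh_real_cong) (auto simp: g_def algebra_simps)
  qed
  have c: "\<theta> ^ k \<le> \<theta> ^ k / \<theta>" "0 < \<theta> ^ k / \<theta>" using \<theta>01 by (auto simp: field_simps)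
  have g_le: "g z \<le> - (\<theta> ^ k / 2)" if "z \<in> D" for z
  proof -
    have "V s z / R \<le> 1/2" using ub[OF st(3,4) that] R by (simp add: R_def field_simps)
    hence "g z \<le> \<theta> ^ k / \<theta> * (- (1/2))" unfolding g_def using c by (intro mult_left_mono) linarith+
    thus ?thesis using c by simp
  qed
  have g_ge: "g z \<ge> - (\<theta> ^ Suc k)" if "z \<in> D" "\<delta> z < s" for z
  proof -
    have "ln (\<delta> z + s) \<le> ln (2 * s)" using that pos st by (subst ln_le_cancel_iff) (auto intro: add_pos_pos)
    also have "\<dots> \<le> - ln (1/s) / 2"
    proof -
      \<comment> \<open>The claim is \<open>2 * s \<le> sqrt s\<close> in logarithmic form, which
        follows from \<open>s \<le> 1/4\<close>.\<close>
      have "2 * ln 2 \<le> ln (1/s)" using lns4 ln_realpow[of 2 2] by simp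
      thus ?thesis using st by (simp add: ln_mult ln_div)
    qed
    finally have "V s z \<ge> ln (1/s) / 2" using lb[OF st(3,4) that(1)] by linarith
    hence "V s z / R \<ge> (ln (1/s) / 2) / R" using R by (intro divide_right_mono) auto
    also have "(ln (1/s) / 2) / R = 2 * (1 / (8 * real q))"
      using R \<open>q \<ge> 1\<close> unfolding R_def by (auto simp: field_simps)
    finally have "V s z / R - 1 \<ge> - \<theta>\<^sup>2" using \<theta>2 by linarith
    hence "\<theta> ^ k / \<theta> * (- \<theta>\<^sup>2) \<le> g z" unfolding g_def using c by (intro mult_left_mono) linarith+
    moreover have "\<theta> ^ k / \<theta> * (- \<theta>\<^sup>2) = - (\<theta> ^ Suc k)" using \<theta>01 by (simp add: power2_eq_square)
    ultimately show ?thesis by simp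
  qed
  have g_mid: "g z \<le> - (\<theta> ^ k)" if "z \<in> D" "\<delta> z > t/2" for z
  proof -
    have "ln (t/4) \<le> ln (\<delta> z - s)" using that(2) st(1,5) by (intro ln_mono) linarith+
    hence "V s z \<le> - ln (t/4)" using ub'[OF st(3,4) that(1)] that(2) st(1,5) by linarith
    also have "\<dots> = ln 4 + ln (1/t)" using st by (simp add: ln_div)
    also have "\<dots> \<le> 2 * ln (1/t)" using lnt by simp
    finally have "V s z / R \<le> 2 * ln (1/t) / R" using R by (intro divide_right_mono) auto
    also have "\<dots> = 1 / (8 * real q)" using lnt ln4 \<open>q \<ge> 1\<close> unfolding R_def lns by (auto simp: field_simps)
    finally have "V s z / R - 1 \<le> - \<theta>" unfolding \<theta> by linarith
    hence "g z \<le> \<theta> ^ k / \<theta> * (- \<theta>)" unfolding g_def using c by (intro mult_left_mono) linarith+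
    thus ?thesis using \<theta>01 by simp
  qed
  define B where "B = {z\<in>D. \<delta> z < t}"
  have Lk: "?L k z = k" if "\<delta> z < t" for z
    using level_eq[OF decseq_bscale[OF t0]] that unfolding t_def by blast
  have open_gt: "open {z\<in>D. \<delta> z > c}" and open_lt: "open {z\<in>D. \<delta> z < c}" for c
  proof -
    have "{z\<in>D. \<delta> z > c} = D \<inter> \<delta> -` {c<..}" "{z\<in>D. \<delta> z < c} = D \<inter> \<delta> -` {..<c}" by auto
    thus "open {z\<in>D. \<delta> z > c}" "open {z\<in>D. \<delta> z < c}" using continuous_open_preimage[OF \<delta> D] by auto
  qed
  let ?F = "\<lambda>z. if z \<in> B then max (f z) (g z) else f z"
  have "psh_real D ?F"
  proof (rule psh_real_glue[OF f(1)])
    show "psh_real B g" using psh_real_subset[OF g_psh] open_lt unfolding B_def by blast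
    show "B \<subseteq> D" by (auto simp: B_def)
    fix z assume z: "z \<in> D - B"
    show "\<exists>W. open W \<and> z \<in> W \<and> (\<forall>w\<in>W \<inter> B. g w \<le> f w)"
    proof (intro exI conjI ballI)
      show "open {z\<in>D. \<delta> z > t/2}" by (rule open_gt)
      show "z \<in> {z\<in>D. \<delta> z > t/2}" using z st by (auto simp: B_def)
      fix w assume w: "w \<in> {z\<in>D. \<delta> z > t/2} \<inter> B"
      thus "g w \<le> f w" using g_mid[of w] f(2)[of w] Lk[of w] by (auto simp: B_def)
    qed
  qed
  moreover have "- (\<theta> ^ ?L (Suc k) z) \<le> ?F z \<and> ?F z \<le> - (\<theta> ^ ?L (Suc k) z / 2)" if z: "z \<in> D" for z
  proof (cases "\<delta> z < t")
    case False
    hence "?L (Suc k) z = ?L k z" using st by (simp add: level_Suc flip: s_def)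
    thus ?thesis using False f(2,3)[OF z] by (simp add: B_def)
  next
    case True
    hence F: "?F z = max (f z) (g z)" using z by (simp add: B_def)
    have fz: "- (\<theta> ^ k) \<le> f z" "f z \<le> - (\<theta> ^ k / 2)" using f(2,3)[OF z] Lk[OF True] by auto
    have \<theta>k: "\<theta> ^ Suc k \<le> \<theta> ^ k" using \<theta>01 by (intro power_decreasing) auto
    show ?thesis
    proof (cases "\<delta> z < s")
      case True
      hence "?L (Suc k) z = Suc k" using Lk[OF \<open>\<delta> z < t\<close>] by (simp add: level_Suc flip: s_def)
      thus ?thesis unfolding F using fz \<theta>k g_ge[OF z True] g_le[OF z] by auto
    next
      case False
      hence "?L (Suc k) z = k" using Lk[OF \<open>\<delta> z < t\<close>] by (simp add: level_Suc flip: s_def)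
      thus ?thesis unfolding F using fz g_le[OF z] by auto
    qed
  qed
  ultimately show ?case by blast
qed

text \<open>Passing to \<open>- ln (- f)\<close> turns the factor 2 between the bounds of the local
  barrier into the additive error \<open>ln 2\<close>, and geometric decay into linear growth of
  slope \<open>\<sigma> = - ln \<theta>\<close>. The error depends neither on \<open>k\<close> nor
  on the boundary point, which makes glueing possible.\<close>

lemma boundary_barrier:
  fixes \<Omega> :: "(complex^'n) set"
  assumes hol: "holder_domain \<Omega>" and pc: "pseudoconvex_domain \<Omega>"
  obtains r t0 \<sigma> :: real where "0 < r" "0 < t0" "t0 \<le> 1/4" "t0 < r/4" "0 < \<sigma>"
    "\<And>x k. x \<in> frontier \<Omega> \<Longrightarrow> \<exists>U. psh_real (\<Omega> \<inter> ball x r) U \<and>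
       (\<forall>z\<in>\<Omega> \<inter> ball x r. \<sigma> * level (bscale t0) k (bdist \<Omega> z) \<le> U z \<and>
          U z \<le> \<sigma> * level (bscale t0) k (bdist \<Omega> z) + ln 2)"
proof -
  obtain r s0 :: real and q :: nat where r: "0 < r" and s0: "0 < s0"
    and shift: "\<And>x. x \<in> frontier \<Omega> \<Longrightarrow> \<exists>v. norm v = 1 \<and> (\<forall>z\<in>\<Omega> \<inter> ball x r. \<forall>s. 0 < s \<and> s < s0 \<longrightarrow>
        z + s *\<^sub>R v \<in> \<Omega> \<and> s ^ q \<le> bdist \<Omega> (z + s *\<^sub>R v))"
    using holder_domain_shift[OF hol] by blast
  have \<Omega>: "open \<Omega>" using pc by (simp add: pseudoconvex_domain_def)
  \<comment> \<open>The scales require \<open>1/4\<close>; \<open>s0/2\<close> makes every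
    \<open>s \<le> t0\<close> an admissible shift; \<open>r/8\<close> puts all scales inside the
    collar of width \<open>r/4\<close> used for glueing.\<close>
  define t0 where "t0 = min (1/4) (min (s0/2) (r/8))"
  have t0: "0 < t0" "t0 \<le> 1/4" "t0 < s0" "t0 < r/4" using r s0 by (auto simp: t0_def)
  \<comment> \<open>\<open>Suc q\<close> is at least 1, as \<open>local_barrier\<close> requires;
    since \<open>s \<le> 1\<close>, the lower bound \<open>s ^ q\<close> for the distance implies
    the one with \<open>s ^ Suc q\<close>.\<close>
  define \<theta> where "\<theta> = 1 - 1 / (8 * real (Suc q))"
  have \<theta>: "0 < \<theta>" "\<theta> < 1" by (auto simp: \<theta>_def field_simps)
  show thesis
  proof (rule that[of r t0 "- ln \<theta>"])
    show "0 < - ln \<theta>" using \<theta> by simp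
    fix x k assume x: "x \<in> frontier \<Omega>"
    hence pos: "bdist \<Omega> z > 0" if "z \<in> \<Omega>" for z
      using bdist_pos[OF \<Omega>] that by blast
    have base: "psh_real \<Omega> (\<lambda>z. - ln (bdist \<Omega> z))"
    proof (rule psh_real_of_psh_on)
      show "psh_on \<Omega> (\<lambda>z. ereal (- ln (bdist \<Omega> z)))" using pc by (simp add: pseudoconvex_domain_def)
      show "continuous_on \<Omega> (\<lambda>z. - ln (bdist \<Omega> z))"
        using pos by (intro continuous_intros continuous_on_bdist) force
    qed
    obtain v where v: "norm v = 1" and sh: "\<And>z s. z \<in> \<Omega> \<inter> ball x r \<Longrightarrow> 0 < s \<Longrightarrow> s < s0 \<Longrightarrow>
        z + s *\<^sub>R v \<in> \<Omega> \<and> s ^ q \<le> bdist \<Omega> (z + s *\<^sub>R v)" using shift[OF x] by blast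
    let ?D = "\<Omega> \<inter> ball x r"
    have dist: "dist (z + s *\<^sub>R v) z = s" "dist z (z + s *\<^sub>R v) = s" if "s > 0" for z s
      using that v by (auto simp: dist_norm)
    have "\<exists>f. psh_real ?D f \<and> (\<forall>z\<in>?D. - (\<theta> ^ level (bscale t0) k (bdist \<Omega> z)) \<le> f z \<and>
           f z \<le> - (\<theta> ^ level (bscale t0) k (bdist \<Omega> z) / 2))"
    proof (rule local_barrier[where V = "\<lambda>s z. - ln (bdist \<Omega> (z + s *\<^sub>R v))" and q = "Suc q"])
      show D: "open ?D" using \<Omega> by blast
      show "continuous_on ?D (bdist \<Omega>)" by (rule continuous_on_bdist)
      fix s :: real assume "0 < s" "s \<le> t0"
      hence s: "0 < s" "s < s0" "s \<le> 1" using t0 by auto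
      show "psh_real ?D (\<lambda>z. - ln (bdist \<Omega> (z + s *\<^sub>R v)))"
        by (rule psh_real_translate[OF base D]) (use sh s in blast)
      fix z assume z: "z \<in> ?D"
      let ?d = "bdist \<Omega> (z + s *\<^sub>R v)"
      have "s ^ Suc q \<le> s ^ q" using s by (intro power_decreasing) auto
      hence d: "s ^ Suc q \<le> ?d" "0 < ?d" using sh[OF z s(1,2)] pos by auto
      have "ln (s ^ Suc q) \<le> ln ?d" using d s by (intro ln_mono zero_less_power)
      thus "- ln ?d \<le> real (Suc q) * ln (1/s)" using s unfolding ln_realpow by (simp add: ln_div)
      have "ln ?d \<le> ln (bdist \<Omega> z + s)"
        using bdist_lipschitz[of \<Omega> "z + s *\<^sub>R v" z] d(2) dist[OF s(1)] by (intro ln_mono) auto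
      thus "- ln (bdist \<Omega> z + s) \<le> - ln ?d" by simp
      assume "s < bdist \<Omega> z"
      hence "ln (bdist \<Omega> z - s) \<le> ln ?d"
        using bdist_lipschitz[of \<Omega> z "z + s *\<^sub>R v"] dist[OF s(1)] by (intro ln_mono) auto
      thus "- ln ?d \<le> - ln (bdist \<Omega> z - s)" by simp
    qed (use t0 pos \<theta>_def in auto)
    then obtain f where f: "psh_real ?D f"
      "\<And>z. z \<in> ?D \<Longrightarrow> - (\<theta> ^ level (bscale t0) k (bdist \<Omega> z)) \<le> f z"
      "\<And>z. z \<in> ?D \<Longrightarrow> f z \<le> - (\<theta> ^ level (bscale t0) k (bdist \<Omega> z) / 2)" by blast
    show "\<exists>U. psh_real ?D U \<and> (\<forall>z\<in>?D. - ln \<theta> * level (bscale t0) k (bdist \<Omega> z) \<le> U z \<and>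
          U z \<le> - ln \<theta> * level (bscale t0) k (bdist \<Omega> z) + ln 2)"
    proof (intro exI conjI ballI)
      have \<theta>n: "\<theta> ^ n / 2 > 0" for n using \<theta> by simp
      have neg: "f z < 0" if "z \<in> ?D" for z
        using f(3)[OF that] \<theta>n[of "level (bscale t0) k (bdist \<Omega> z)"] by linarith
      thus "psh_real ?D (\<lambda>z. - ln (- f z))" by (rule psh_real_minus_ln[OF f(1)])
      fix z assume z: "z \<in> ?D"
      let ?n = "level (bscale t0) k (bdist \<Omega> z)"
      have "ln (- f z) \<le> ln (\<theta> ^ ?n)" using f(2)[OF z] neg[OF z] by (intro ln_mono) auto
      thus "- ln \<theta> * ?n \<le> - ln (- f z)" by (simp add: ln_realpow mult.commute)
      have "ln (\<theta> ^ ?n / 2) \<le> ln (- f z)" using f(3)[OF z] \<theta>n[of ?n] by (intro ln_mono) linarith+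
      moreover have "ln (\<theta> ^ ?n / 2) = ?n * ln \<theta> - ln 2" using \<theta> by (simp add: ln_divide_pos ln_realpow)
      ultimately show "- ln (- f z) \<le> - ln \<theta> * ?n + ln 2" by (simp add: mult.commute)
    qed
  qed (use r t0 in auto)
qed

section \<open>Globalisation\<close>

text \<open>The penalty \<open>K (r\<^sup>2 - |z - p|\<^sup>2)\<close> with \<open>K = 3 / r\<^sup>2\<close> exceeds the oscillation \<open>ln 2\<close> between two local
  barriers, so the maximum over \<open>p\<close> never sees the edge of the ball around \<open>p\<close>. Adding \<open>K |z|\<^sup>2\<close>
  makes the penalties affine, whence no upper bound on their Levi form is needed.\<close>

lemma psh_exhaustion:
  fixes \<Omega> :: "(complex^'n) set"
  assumes hol: "holder_domain \<Omega>" and pc: "pseudoconvex_domain \<Omega>"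
  obtains t0 \<sigma> C :: real where "0 < t0" "t0 \<le> 1/4" "0 < \<sigma>" "0 \<le> C"
    "\<And>k. \<exists>F. psh_real \<Omega> F \<and>
       (\<forall>z\<in>\<Omega>. F z \<le> \<sigma> * level (bscale t0) k (bdist \<Omega> z) + C \<and>
          (bdist \<Omega> z < bscale t0 k \<longrightarrow> \<sigma> * k \<le> F z))"
proof -
  obtain r t0 \<sigma> :: real where r: "0 < r" and t0: "0 < t0" "t0 \<le> 1/4" "t0 < r/4" and \<sigma>: "0 < \<sigma>"
    and barrier: "\<And>x k. x \<in> frontier \<Omega> \<Longrightarrow> \<exists>U. psh_real (\<Omega> \<inter> ball x r) U \<and>
       (\<forall>z\<in>\<Omega> \<inter> ball x r. \<sigma> * level (bscale t0) k (bdist \<Omega> z) \<le> U z \<and>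
          U z \<le> \<sigma> * level (bscale t0) k (bdist \<Omega> z) + ln 2)"
    using boundary_barrier[OF hol pc] by metis
  have \<Omega>: "open \<Omega>" "bounded \<Omega>" "\<Omega> \<noteq> {}" using hol by (auto simp: holder_domain_def)
  have ne: "frontier \<Omega> \<noteq> {}" by (rule bounded_frontier_nonempty) (use \<Omega> in auto)
  \<comment> \<open>Points of the collar are within \<open>r/4\<close> of the boundary, hence within
    \<open>r/2\<close> of some centre, as \<open>E_edge\<close> demands.\<close>
  obtain P where P: "P \<subseteq> frontier \<Omega>" "finite P" "frontier \<Omega> \<subseteq> (\<Union>p\<in>P. ball p (r/4))"
  proof (rule compactE_image[of "frontier \<Omega>" "frontier \<Omega>" "\<lambda>p. ball p (r/4)"])
    show "compact (frontier \<Omega>)" using \<Omega> by (simp add: compact_frontier_bounded)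
    show "frontier \<Omega> \<subseteq> (\<Union>p\<in>frontier \<Omega>. ball p (r/4))" using r by force
  qed auto
  obtain R where R: "\<And>z. z \<in> \<Omega> \<Longrightarrow> norm z \<le> R" using \<Omega>(2) bounded_iff by blast
  define K where "K = 3 / r\<^sup>2"
  have K: "K > 0" "K * r\<^sup>2 = 3" using r by (auto simp: K_def)
  have ln2: "ln (2::real) \<le> 1" "ln (2::real) \<ge> 0" using ln_le_minus_one[of "2::real"] by auto
  \<comment> \<open>The summand 4 covers \<open>K * r\<^sup>2 = 3\<close> and
    \<open>ln 2 \<le> 1\<close>; \<open>K * R\<^sup>2\<close> covers the added square norm.\<close>
  define C where "C = 4 + K * R\<^sup>2"
  have C: "C \<ge> 0" using K by (simp add: C_def)
  define N where "N = {z\<in>\<Omega>. bdist \<Omega> z < r/4}"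
  have openN: "open N"
  proof -
    have "N = \<Omega> \<inter> bdist \<Omega> -` {..<r/4}" by (auto simp: N_def)
    thus ?thesis using continuous_open_preimage[OF continuous_on_bdist \<Omega>(1)] by auto
  qed
  have near: "\<exists>p\<in>P. dist z p < r/2" if "z \<in> N" for z
  proof -
    obtain x where x: "x \<in> frontier \<Omega>" "infdist z (frontier \<Omega>) = dist z x"
      using infdist_attains_inf[OF frontier_closed ne] by blast
    hence "dist z x < r/4" using that by (simp add: N_def bdist_def)
    moreover obtain p where "p \<in> P" "dist p x < r/4" using P(3) x(1) by force
    ultimately show ?thesis using dist_triangle[of z p x] by (force simp: dist_commute)
  qed
  show thesis
  proof (rule that[of t0 \<sigma> C])
    fix k
    define n where "n z = \<sigma> * level (bscale t0) k (bdist \<Omega> z)" for z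
    have n0: "n z \<ge> 0" for z using \<sigma> by (simp add: n_def)
    have "\<exists>U. \<forall>p\<in>P. psh_real (\<Omega> \<inter> ball p r) (U p) \<and>
        (\<forall>z\<in>\<Omega> \<inter> ball p r. n z \<le> U p z \<and> U p z \<le> n z + ln 2)"
      unfolding n_def using P(1) by (intro bchoice ballI barrier) blast
    then obtain U where U: "\<And>p. p \<in> P \<Longrightarrow> psh_real (\<Omega> \<inter> ball p r) (U p)"
      "\<And>p z. p \<in> P \<Longrightarrow> z \<in> \<Omega> \<inter> ball p r \<Longrightarrow> n z \<le> U p z"
      "\<And>p z. p \<in> P \<Longrightarrow> z \<in> \<Omega> \<inter> ball p r \<Longrightarrow> U p z \<le> n z + ln 2" by blast
    define E where "E p z = U p z + K * (r\<^sup>2 - (norm (z - p))\<^sup>2) + K * (norm z)\<^sup>2" for p z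
    have E_psh: "psh_real (\<Omega> \<inter> ball p r) (E p)" if "p \<in> P" for p
    proof -
      have "psh_real (\<Omega> \<inter> ball p r) (\<lambda>z. 1 * U p z + z \<bullet> ((2 * K) *\<^sub>R p) + K * (r\<^sup>2 - (norm p)\<^sup>2))"
        by (intro psh_real_affine U that) simp
      thus ?thesis
        by (rule psh_real_cong)
           (simp add: E_def power2_norm_eq_inner inner_diff_left inner_diff_right inner_commute algebra_simps)
    qed
    have pen: "K * (norm (z - p))\<^sup>2 \<le> 3 * c\<^sup>2" if "dist z p \<le> c * r" for z p c
    proof -
      have "(norm (z - p))\<^sup>2 \<le> (c * r)\<^sup>2" using that by (intro power_mono) (auto simp: dist_norm)
      hence "K * (norm (z - p))\<^sup>2 \<le> K * (c * r)\<^sup>2" using K by (intro mult_left_mono) auto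
      also have "\<dots> = (K * r\<^sup>2) * c\<^sup>2" by (simp add: power_mult_distrib)
      finally show ?thesis using K by simp
    qed
    have pen': "3 * c\<^sup>2 \<le> K * (norm (z - p))\<^sup>2" if "c * r \<le> dist z p" "c \<ge> 0" for z p c
    proof -
      have "(c * r)\<^sup>2 \<le> (norm (z - p))\<^sup>2" using that r by (intro power_mono) (auto simp: dist_norm)
      hence "K * (c * r)\<^sup>2 \<le> K * (norm (z - p))\<^sup>2" using K by (intro mult_left_mono) auto
      moreover have "K * (c * r)\<^sup>2 = (K * r\<^sup>2) * c\<^sup>2" by (simp add: power_mult_distrib)
      ultimately show ?thesis using K by simp
    qed
    have E_eq: "E p z = U p z + 3 - K * (norm (z - p))\<^sup>2 + K * (norm z)\<^sup>2" for p z
      using K(2) by (simp add: E_def right_diff_distrib)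
    have E_le: "E p z \<le> n z + C" if "p \<in> P" "z \<in> \<Omega> \<inter> ball p r" for p z
    proof -
      have "(norm z)\<^sup>2 \<le> R\<^sup>2" using R[of z] that by (intro power_mono) auto
      hence "K * (norm z)\<^sup>2 \<le> K * R\<^sup>2" using K by (intro mult_left_mono) auto
      moreover have "K * (norm (z - p))\<^sup>2 \<ge> 0" using K by simp
      ultimately show ?thesis unfolding E_eq C_def using U(3)[OF that] ln2 by linarith
    qed
    have E_ge: "n z \<le> E p z" if "p \<in> P" "z \<in> \<Omega> \<inter> ball p r" for p z
    proof -
      have "K * (norm (z - p))\<^sup>2 \<le> 3" using pen[of z p 1] that by (auto simp: dist_commute)
      moreover have "K * (norm z)\<^sup>2 \<ge> 0" using K by simp
      ultimately show ?thesis unfolding E_eq using U(2)[OF that] by linarith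
    qed
    \<comment> \<open>The two penalty terms are at least \<open>3 * (13/16)\<^sup>2 > 1.98\<close>
      and at most \<open>3/4\<close>; their difference exceeds 1 and hence the oscillation
      \<open>ln 2\<close>.\<close>
    have E_edge: "E p z \<le> E p' z"
      if "p \<in> P" "p' \<in> P" "z \<in> \<Omega> \<inter> ball p r" "13/16 * r \<le> dist z p" "dist z p' \<le> r/2" for p p' z
    proof -
      have "z \<in> \<Omega> \<inter> ball p' r" using that r by (auto simp: dist_commute)
      thus ?thesis
        unfolding E_eq using U(3)[OF that(1,3)] U(2)[OF that(2)] ln2(1)
          pen'[OF that(4)] pen[of z p' "1/2"] that(5) by (fastforce simp: power2_eq_square)
    qed
    define A where "A z = {p\<in>P. z \<in> ball p r}" for z
    define G where "G z = Max ((\<lambda>p. E p z) ` A z)" for z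
    have finA: "finite (A z)" for z using P(2) by (simp add: A_def)
    have neA: "A z \<noteq> {}" if "z \<in> N" for z
      using near[OF that] r by (force simp: A_def dist_commute)
    have G_psh: "psh_real N G"
    proof (rule psh_real_local[OF openN])
      fix z0 assume z0: "z0 \<in> N"
      \<comment> \<open>A fixed index set that computes \<open>G\<close> near \<open>z0\<close> in
        place of the varying \<open>A z\<close>. For \<open>z\<close> within \<open>r/16\<close> of
        \<open>z0\<close>, centres in \<open>P1\<close> are at distance below \<open>r\<close>, so
        \<open>W\<close> lies in their balls; all other centres are at distance at least
        \<open>13/16 * r\<close> and lose by \<open>E_edge\<close>.\<close>
      define P1 where "P1 = {p\<in>P. dist z0 p \<le> 7/8 * r}"
      define W where "W = N \<inter> ball z0 (r/16)"
      have W: "open W" using openN by (auto simp: W_def)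
      have fin: "finite P1" using P(2) by (simp add: P1_def)
      have ne1: "P1 \<noteq> {}" using near[OF z0] r by (force simp: P1_def)
      have sub: "z \<in> \<Omega> \<inter> ball p r" if "z \<in> W" "p \<in> P1" for z p
        using that dist_triangle[of p z z0] r by (auto simp: W_def P1_def N_def dist_commute)
      have "psh_real W (\<lambda>z. Max ((\<lambda>p. E p z) ` P1))"
      proof (rule psh_real_Max[OF fin ne1])
        fix p assume p: "p \<in> P1"
        show "psh_real W (E p)"
          by (rule psh_real_subset[OF E_psh W]) (use p sub in \<open>auto simp: P1_def\<close>)
      qed
      hence "psh_real W G"
      proof (rule psh_real_cong)
        fix z assume z: "z \<in> W"
        have zN: "z \<in> N" using z by (simp add: W_def)
        have "G z \<le> Max ((\<lambda>p. E p z) ` P1)" unfolding G_def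
        proof (rule Max.boundedI)
          fix e assume "e \<in> (\<lambda>p. E p z) ` A z"
          then obtain p where p: "p \<in> A z" "e = E p z" by blast
          have "\<exists>p'\<in>P1. E p z \<le> E p' z"
          proof (cases "p \<in> P1")
            case False
            hence "7/8 * r < dist z0 p" using p by (simp add: P1_def A_def)
            hence far: "13/16 * r \<le> dist z p"
              using z dist_triangle[of z0 p z] by (simp add: W_def)
            obtain p' where p': "p' \<in> P" "dist z p' < r/2" using near[OF zN] by blast
            have "dist z0 z < r/16" using z by (simp add: W_def)
            hence "dist z0 p' \<le> 7/8 * r" using p'(2) dist_triangle[of z0 p' z] r by linarith
            hence "p' \<in> P1" using p' by (simp add: P1_def)
            moreover have "E p z \<le> E p' z"
              using p p' far zN by (intro E_edge) (auto simp: A_def N_def)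
            ultimately show ?thesis by blast
          qed blast
          thus "e \<le> Max ((\<lambda>p. E p z) ` P1)" using p(2) fin by (auto intro: order_trans[OF _ Max_ge])
        qed (use finA neA[OF zN] in auto)
        moreover have "Max ((\<lambda>p. E p z) ` P1) \<le> G z" unfolding G_def
        proof (rule Max_mono)
          show "(\<lambda>p. E p z) ` P1 \<subseteq> (\<lambda>p. E p z) ` A z" using sub[OF z] by (auto simp: A_def P1_def)
        qed (use finA ne1 in auto)
        ultimately show "G z = Max ((\<lambda>p. E p z) ` P1)" by simp
      qed
      thus "\<exists>W. z0 \<in> W \<and> W \<subseteq> N \<and> psh_real W G"
        using z0 r by (intro exI[of _ W]) (auto simp: W_def)
    qed
    have G_le: "G z \<le> n z + C" if "z \<in> N" for z
      unfolding G_def using finA neA[OF that] that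
      by (intro Max.boundedI) (auto intro: E_le simp: A_def N_def)
    have G_ge: "n z \<le> G z" if zN: "z \<in> N" for z
    proof -
      obtain p where p: "p \<in> A z" using neA[OF zN] by blast
      hence "n z \<le> E p z" using zN by (intro E_ge) (auto simp: A_def N_def)
      also have "\<dots> \<le> G z" unfolding G_def using p finA by (intro Max_ge) auto
      finally show ?thesis .
    qed
    \<comment> \<open>The constant \<open>C\<close> continues \<open>G\<close> into the interior:
      where the boundary distance exceeds \<open>t0\<close> no scale is counted, so
      \<open>n = 0\<close> and \<open>G \<le> C\<close>. As \<open>t0 < r/4\<close>, this open set
      contains \<open>\<Omega> - N\<close>.\<close>
    let ?F = "\<lambda>z. if z \<in> N then max C (G z) else C"
    have "psh_real \<Omega> ?F"
    proof (rule psh_real_glue[OF psh_real_const[OF \<Omega>(1)] G_psh])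
      show "N \<subseteq> \<Omega>" by (auto simp: N_def)
      fix z assume z: "z \<in> \<Omega> - N"
      show "\<exists>W. open W \<and> z \<in> W \<and> (\<forall>w\<in>W \<inter> N. G w \<le> C)"
      proof (intro exI conjI ballI)
        have "open (\<Omega> \<inter> bdist \<Omega> -` {t0<..})"
          by (intro continuous_open_preimage continuous_on_bdist \<Omega>) auto
        moreover have "\<Omega> \<inter> bdist \<Omega> -` {t0<..} = {w\<in>\<Omega>. t0 < bdist \<Omega> w}" by auto
        ultimately show "open {w\<in>\<Omega>. t0 < bdist \<Omega> w}" by simp
        show "z \<in> {w\<in>\<Omega>. t0 < bdist \<Omega> w}" using z t0 by (auto simp: N_def)
        fix w assume w: "w \<in> {w\<in>\<Omega>. t0 < bdist \<Omega> w} \<inter> N"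
        have "level (bscale t0) k (bdist \<Omega> w) \<le> 0"
          using w by (intro level_le_index[OF decseq_bscale[OF t0(1,2)]]) (simp add: bscale_def)
        hence "n w = 0" by (simp add: n_def)
        thus "G w \<le> C" using G_le[of w] w by simp
      qed
    qed
    moreover have "?F z \<le> n z + C" if "z \<in> \<Omega>" for z
      using n0[of z] G_le[of z] by auto
    moreover have "\<sigma> * k \<le> ?F z" if "z \<in> \<Omega>" "bdist \<Omega> z < bscale t0 k" for z
    proof -
      have "z \<in> N" using that bscale_bounds(3)[OF t0(1,2), of k] t0(3) by (simp add: N_def)
      moreover have "n z = \<sigma> * k"
        using level_eq[OF decseq_bscale[OF t0(1,2)] that(2)] by (simp add: n_def)
      ultimately show ?thesis using G_ge[of z] by simp
    qed
    ultimately show "\<exists>F. psh_real \<Omega> F \<and>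
       (\<forall>z\<in>\<Omega>. F z \<le> \<sigma> * level (bscale t0) k (bdist \<Omega> z) + C \<and>
          (bdist \<Omega> z < bscale t0 k \<longrightarrow> \<sigma> * k \<le> F z))"
      unfolding n_def by blast
  qed (use t0 \<sigma> C in auto)
qed

section \<open>Lower bounds for the relative extremal function\<close>

lemma rel_extremal_geI:
  assumes "psh_real \<Omega> u" "\<And>x. x \<in> \<Omega> \<Longrightarrow> u x < 0" "\<And>x. x \<in> cball p r \<Longrightarrow> u x \<le> -1"
  shows "ereal (u z) \<le> rel_extremal \<Omega> p r z"
  unfolding rel_extremal_def
  by (rule SUP_upper2[of "\<lambda>x. ereal (u x)"]) (use assms psh_on_of_psh_real in \<open>auto simp: one_ereal_def\<close>)

text \<open>The ball stays above a fixed scale \<open>bscale t0 i\<close>, so \<open>F\<close> is at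
  most \<open>\<sigma> * i + C\<close> on it, whereas near the boundary \<open>F\<close> is within
  \<open>C\<close> of its upper bound \<open>\<sigma> * k + C\<close>. Normalising this drop to 1
  leaves an error of order \<open>1 / k\<close> near the boundary.\<close>

lemma rel_extremal_decay:
  fixes \<Omega> :: "(complex^'n) set"
  assumes hol: "holder_domain \<Omega>" and pc: "pseudoconvex_domain \<Omega>"
    and B: "cball p r \<subseteq> \<Omega>" "0 < r"
  obtains t0 c :: real and k0 :: nat where "0 < t0" "t0 \<le> 1/4" "0 < c"
    "\<And>k z. k0 \<le> k \<Longrightarrow> z \<in> \<Omega> \<Longrightarrow> bdist \<Omega> z < bscale t0 k \<Longrightarrow>
       ereal (- (c / k)) \<le> rel_extremal \<Omega> p r z"
proof -
  obtain t0 \<sigma> C :: real where t0: "0 < t0" "t0 \<le> 1/4" and \<sigma>: "0 < \<sigma>" and C: "0 \<le> C"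
    and ex: "\<And>k. \<exists>F. psh_real \<Omega> F \<and>
       (\<forall>z\<in>\<Omega>. F z \<le> \<sigma> * level (bscale t0) k (bdist \<Omega> z) + C \<and>
          (bdist \<Omega> z < bscale t0 k \<longrightarrow> \<sigma> * k \<le> F z))"
    using psh_exhaustion[OF hol pc] by metis
  have \<Omega>: "open \<Omega>" "bounded \<Omega>" "\<Omega> \<noteq> {}" using hol by (auto simp: holder_domain_def)
  have ne: "frontier \<Omega> \<noteq> {}" by (rule bounded_frontier_nonempty) (use \<Omega> in auto)
  obtain w where w: "w \<in> cball p r" "\<And>z. z \<in> cball p r \<Longrightarrow> bdist \<Omega> w \<le> bdist \<Omega> z"
    using continuous_attains_inf[OF compact_cball _ continuous_on_bdist, of p r \<Omega>] B(2) by fastforce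
  have "bdist \<Omega> w > 0" using bdist_pos[OF \<Omega>(1) ne] w(1) B(1) by blast
  hence "\<forall>\<^sub>F i in sequentially. bscale t0 i < bdist \<Omega> w"
    using order_tendstoD(2)[OF bscale_tendsto_0[OF t0]] by blast
  then obtain i where i: "bscale t0 i < bdist \<Omega> w" by (auto simp: eventually_sequentially)
  show thesis
  proof (rule that[of t0 "2 * (C + 1) / \<sigma>" "max 1 (2 * i)"])
    show "0 < 2 * (C + 1) / \<sigma>" using C \<sigma> by simp
    fix k z assume k: "max 1 (2 * i) \<le> k" and z: "z \<in> \<Omega>" "bdist \<Omega> z < bscale t0 k"
    obtain F where F: "psh_real \<Omega> F"
      "\<And>z. z \<in> \<Omega> \<Longrightarrow> F z \<le> \<sigma> * level (bscale t0) k (bdist \<Omega> z) + C"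
      "\<And>z. z \<in> \<Omega> \<Longrightarrow> bdist \<Omega> z < bscale t0 k \<Longrightarrow> \<sigma> * k \<le> F z"
      using ex[of k] by blast
    \<comment> \<open>\<open>S\<close> exceeds the upper bound of \<open>F\<close> by 1, for strict
      negativity, and \<open>S - Q\<close> is the bound \<open>\<sigma> * i + C\<close> on the ball.
      By \<open>k \<ge> 2 * i\<close>, \<open>Q\<close> is at least
      \<open>\<sigma> * k / 2\<close>.\<close>
    define S where "S = \<sigma> * k + C + 1"
    define Q where "Q = \<sigma> * (real k - i) + 1"
    have ki: "real k - i \<ge> real k / 2" "real k > 0" using k by auto
    hence "\<sigma> * (real k - i) \<ge> \<sigma> * (real k / 2)" using \<sigma> by (intro mult_left_mono) auto
    hence Q: "Q \<ge> \<sigma> * k / 2" by (simp add: Q_def)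
    have Q0: "\<sigma> * k / 2 > 0" "Q > 0" using \<sigma> ki Q by (auto intro: less_le_trans[of _ "\<sigma> * k / 2"])
    define u where "u z = (F z - S) / Q" for z
    have "ereal (u z) \<le> rel_extremal \<Omega> p r z"
    proof (rule rel_extremal_geI)
      have "psh_real \<Omega> (\<lambda>z. (1/Q) * F z + z \<bullet> 0 + (- S/Q))" using Q0 by (intro psh_real_affine F) simp
      thus "psh_real \<Omega> u" by (rule psh_real_cong) (simp add: u_def diff_divide_distrib)
      fix x assume x: "x \<in> \<Omega>"
      have "\<sigma> * level (bscale t0) k (bdist \<Omega> x) \<le> \<sigma> * k" using \<sigma> level_le by (intro mult_left_mono) auto
      hence "F x < S" using F(2)[OF x] by (simp add: S_def)
      thus "u x < 0" using Q0 by (simp add: u_def divide_neg_pos)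
    next
      fix x assume x: "x \<in> cball p r"
      hence "level (bscale t0) k (bdist \<Omega> x) \<le> i"
        using w(2)[OF x] i by (intro level_le_index[OF decseq_bscale[OF t0]]) simp
      hence "\<sigma> * level (bscale t0) k (bdist \<Omega> x) \<le> \<sigma> * i" using \<sigma> by (intro mult_left_mono) auto
      hence "F x - S \<le> - Q" using F(2)[of x] x B(1) unfolding S_def Q_def right_diff_distrib by fastforce
      thus "u x \<le> -1" using Q0 by (simp add: u_def field_simps)
    qed
    moreover have "- (2 * (C + 1) / \<sigma> / k) \<le> u z"
    proof -
      have "- ((C + 1) / Q) \<le> u z"
        unfolding u_def minus_divide_left using F(3)[OF z] Q0 by (intro divide_right_mono) (auto simp: S_def)
      moreover have "(C + 1) / Q \<le> (C + 1) / (\<sigma> * k / 2)" using C Q Q0 by (intro divide_left_mono) auto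
      moreover have "(C + 1) / (\<sigma> * k / 2) = 2 * (C + 1) / \<sigma> / k" by simp
      ultimately show ?thesis by linarith
    qed
    ultimately show "ereal (- (2 * (C + 1) / \<sigma> / k)) \<le> rel_extremal \<Omega> p r z"
      by (meson ereal_less_eq(3) order_trans)
  qed (use t0 in auto)
qed

section \<open>The tower sequence\<close>

text \<open>The reciprocals of the absolute values of the recursive sequence, with the index
  shifted: \<open>tower n\<close> belongs to index \<open>n + 1\<close>, and
  \<open>tower 0 = 2\<close> to the starting value \<open>- 1/2\<close>.\<close>

primrec tower :: "nat \<Rightarrow> real" where
  "tower 0 = 2"
| "tower (Suc n) = exp (exp (tower n))"

lemma tower_ge: "tower n \<ge> 2 * real n + 2"
proof (induction n)
  case (Suc n)
  have "exp (exp (tower n)) \<ge> 1 + (1 + tower n)"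
    using exp_ge_add_one_self[of "tower n"] exp_ge_add_one_self[of "exp (tower n)"] by linarith
  thus ?case using Suc by simp
qed simp

lemma tower_pos: "tower n > 0"
  using tower_ge[of n] by linarith

text \<open>The reciprocals are compared after two logarithms. With \<open>L = ln (1 / t0)\<close>,
  the scale of index \<open>k = 2 ^ (n + 2)\<close> leaves \<open>k * ln 8 + ln L\<close>, of order
  \<open>2 ^ n\<close>, while \<open>tower (n + 2)\<close> leaves
  \<open>exp (exp (tower n))\<close>, which is at least \<open>exp (2 * n)\<close>. The shift by 2
  exposes the four exponentials.\<close>

lemma inverse_tower_less_bscale:
  assumes "0 < t0" "t0 \<le> 1/4"
  shows "\<forall>\<^sub>F n in sequentially. 1 / tower n < bscale t0 (2 ^ n)"
proof -
  define L where "L = ln (1 / t0)"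
  have L: "L > 0" unfolding L_def using assms by (intro ln_gt_zero) auto
  have "\<forall>\<^sub>F n in sequentially. 2 ^ (n + 2) * ln 8 + ln L < exp (2 * real n)"
    by real_asymp
  hence "\<forall>\<^sub>F n in sequentially. 1 / tower (n + 2) < bscale t0 (2 ^ (n + 2))"
  proof eventually_elim
    case (elim n)
    let ?k = "2 ^ (n + 2) :: nat"
    have "exp (2 * real n) \<le> exp (tower n)" using tower_ge[of n] by simp
    also have "\<dots> \<le> exp (exp (tower n))"
      using exp_ge_add_one_self[of "exp (tower n)"] by linarith
    finally have "real ?k * ln 8 + ln L < exp (exp (tower n))" using elim
      unfolding of_nat_power of_nat_numeral by linarith
    hence "exp (real ?k * ln 8 + ln L) < exp (exp (exp (tower n)))" by (rule exp_less_mono)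
    moreover have "exp (real ?k * ln 8 + ln L) = real (8 ^ ?k) * L"
      unfolding exp_add exp_of_nat_mult using L by simp
    ultimately have "real (8 ^ ?k) * L < exp (exp (exp (tower n)))" by linarith
    hence "exp (real (8 ^ ?k) * L) < exp (exp (exp (exp (tower n))))" by (rule exp_less_mono)
    moreover have "tower (n + 2) = exp (exp (exp (exp (tower n))))" by simp
    ultimately have "exp (real (8 ^ ?k) * L) < tower (n + 2)" by metis
    moreover have "exp (real (8 ^ ?k) * L) = (1 / t0) ^ (8 ^ ?k)"
      using assms by (simp only: exp_of_nat_mult) (simp add: L_def)
    ultimately have "(1 / t0) ^ (8 ^ ?k) < tower (n + 2)" by metis
    hence "1 / tower (n + 2) < 1 / (1 / t0) ^ (8 ^ ?k)"
      using assms by (intro divide_strict_left_mono) (auto intro!: mult_pos_pos tower_pos simp del: tower.simps)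
    thus ?case by (simp add: bscale_def power_one_over del: tower.simps)
  qed
  thus ?thesis
    by (rule eventually_sequentially_seg[THEN iffD1])
qed

lemma tendsto_neg_inverse_tower: "(\<lambda>n. - (1 / tower n)) \<longlonglongrightarrow> 0"
proof (rule real_tendsto_sandwich[of "\<lambda>n. - (1 / (2 * real n + 2))" _ _ "\<lambda>_. 0"])
  show "\<forall>\<^sub>F n in sequentially. - (1 / (2 * real n + 2)) \<le> - (1 / tower n)"
    using tower_ge by (intro always_eventually allI) (auto intro!: divide_left_mono mult_pos_pos tower_pos)
  show "\<forall>\<^sub>F n in sequentially. - (1 / tower n) \<le> 0"
    using tower_pos by (intro always_eventually allI) (simp add: less_imp_le)
  show "(\<lambda>n. - (1 / (2 * real n + 2))) \<longlonglongrightarrow> 0" by real_asymp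
qed simp

text \<open>\<open>psi\<close> and \<open>phi\<close> keep their trivial constants so as to agree
  literally with the instantiated statement. They amount to \<open>1 / ln (- t)\<close> on the
  interval from -1 to 0 and to \<open>- 2 * exp (1 / t)\<close> for \<open>t < 0\<close>.\<close>

definition psi :: "real \<Rightarrow> real" where
  "psi t = - 1 * (- ln (- t)) powr (- 1)"

definition phi :: "real \<Rightarrow> real" where
  "phi t = - 2 * exp (- 1 / ((- t) powr (1 / (1/2) - 1)))"

lemma psi_eq:
  assumes "t \<in> {-1<..<0}"
  shows "psi t = 1 / ln (- t)"
proof -
  have "- ln (- t) > 0" using assms by simp
  thus ?thesis unfolding psi_def by (simp add: powr_minus_divide)
qed

lemma psi_inverse:
  assumes "y < 0"
  shows "- exp (1/y) \<in> {-1<..<0}" "psi (- exp (1/y)) = y"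
proof -
  show "- exp (1/y) \<in> {-1<..<0}" using assms by simp
  thus "psi (- exp (1/y)) = y" by (subst psi_eq) auto
qed

lemma psi_strict_mono: "strict_mono_on {-1<..<0} psi"
proof (rule strict_mono_onI)
  fix s t :: real assume st: "s \<in> {-1<..<0}" "t \<in> {-1<..<0}" "s < t"
  hence "ln (- t) < ln (- s)" "ln (- s) < 0" by auto
  hence "1 / ln (- s) < 1 / ln (- t)" by (intro divide_strict_left_mono mult_neg_neg) auto
  thus "psi s < psi t" using st by (simp add: psi_eq)
qed

lemma psi_bij: "bij_betw psi {-1<..<0} {..<0}"
  unfolding bij_betw_def
proof
  show "inj_on psi {-1<..<0}" using psi_strict_mono by (rule strict_mono_on_imp_inj_on)
  have "psi t < 0" if "t \<in> {-1<..<0}" for t using that by (simp add: psi_eq divide_pos_neg)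
  moreover have "y \<in> psi ` {-1<..<0}" if "y < 0" for y
    using psi_inverse[OF that] by (metis imageI)
  ultimately show "psi ` {-1<..<0} = {..<0}" by auto
qed

text \<open>With \<open>T = tower n\<close>, \<open>phi (- (1 / T)) / 2 = - exp (- T)\<close>, the
  constant 2 in \<open>phi\<close> cancelling the halving. The inverse of \<open>psi\<close> sends
  \<open>y\<close> to \<open>- exp (1 / y)\<close>, which gives
  \<open>- exp (- exp T)\<close>.\<close>

lemma aseq_tower: "aseq (\<lambda>s. the_inv_into {-1<..<0} psi (phi s / 2)) (- 1 / 2) n = - (1 / tower n)"
proof (induction n)
  case (Suc n)
  let ?s = "- (1 / tower n)"
  have "phi ?s / 2 = - exp (- tower n)" using tower_pos[of n] by (simp add: phi_def)
  moreover have "the_inv_into {-1<..<0} psi (- exp (- tower n)) = - exp (1 / (- exp (- tower n)))"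
    using psi_inverse[of "- exp (- tower n)"] psi_bij
    by (intro the_inv_into_f_eq) (auto simp: bij_betw_def)
  moreover have "- exp (1 / (- exp (- tower n))) = - (1 / tower (Suc n))"
    by (simp add: exp_minus divide_inverse)
  ultimately show ?case using Suc by simp
qed simp

text \<open>\<open>Max\<close> needs a finite nonempty set: the linear lower bound for
  \<open>tower\<close> limits the indices, and \<open>t < 1/2\<close> admits index 1.\<close>

lemma Max_tower:
  assumes "0 < t" "t < 1/2"
  defines "m \<equiv> Max {\<nu>::nat. 1 \<le> \<nu> \<and> - (1 / tower (\<nu> - 1)) \<le> - t}"
  shows "1 \<le> m" "t \<le> 1 / tower (m - 1)"
proof -
  let ?A = "{\<nu>::nat. 1 \<le> \<nu> \<and> - (1 / tower (\<nu> - 1)) \<le> - t}"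
  have "?A \<subseteq> {..nat \<lceil>1/t\<rceil>}"
  proof
    fix \<nu> assume \<nu>: "\<nu> \<in> ?A"
    hence "tower (\<nu> - 1) \<le> 1 / t" using assms(1) tower_pos[of "\<nu> - 1"] by (simp add: field_simps)
    hence "real \<nu> \<le> 1 / t" using tower_ge[of "\<nu> - 1"] \<nu> by (auto simp: of_nat_diff)
    thus "\<nu> \<in> {..nat \<lceil>1/t\<rceil>}" by (simp add: le_nat_iff) linarith
  qed
  hence "finite ?A" using finite_subset by blast
  moreover have "1 \<in> ?A" using assms(2) by simp
  ultimately have "m \<in> ?A" unfolding m_def by (intro Max_in) auto
  thus "1 \<le> m" "t \<le> 1 / tower (m - 1)" by auto
qed

theorem theorem1p3:
  fixes \<Omega> :: "(complex^'n) set"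
  assumes "holder_domain \<Omega>" and "pseudoconvex_domain \<Omega>"
  shows "\<exists>\<alpha> \<beta> A C1 C2 \<alpha>1::real. 0 < \<alpha> \<and> \<alpha> < 1 \<and> 0 < \<beta> \<and> 0 < A \<and> 0 < C1 \<and> 0 < C2 \<and>
     -1 < \<alpha>1 \<and> \<alpha>1 < 0 \<and>
     (let \<psi> = (\<lambda>t::real. - C1 * (- ln (- t)) powr (- \<beta>));
          \<phi> = (\<lambda>t::real. - C2 * exp (- A / ((- t) powr (1 / \<alpha> - 1))));
          \<alpha>s = (\<lambda>\<nu>::nat. aseq (\<lambda>s. the_inv_into {-1<..<0} \<psi> (\<phi> s / 2)) \<alpha>1 (\<nu> - 1));
          lam = (\<lambda>t::real. Max {\<nu>::nat. 1 \<le> \<nu> \<and> \<alpha>s \<nu> \<le> - t})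
      in bij_betw \<psi> {-1<..<0} {..<0} \<and> strict_mono_on {-1<..<0} \<psi> \<and>
         (\<forall>\<nu>\<ge>1. \<alpha>s \<nu> < 0 \<and> \<alpha>s \<nu> \<le> \<alpha>s (\<nu> + 1)) \<and> (\<alpha>s \<longlonglongrightarrow> 0) \<and>
         (\<forall>p r. 0 < r \<longrightarrow> cball p r \<subseteq> \<Omega> \<longrightarrow>
            (\<exists>\<epsilon>0 c. 0 < \<epsilon>0 \<and> 0 < c \<and>
               (\<forall>z\<in>\<Omega>. bdist \<Omega> z < - \<alpha>1 \<longrightarrow>
                  ereal (- c * exp (- \<epsilon>0 * real (lam (bdist \<Omega> z)))) \<le> rel_extremal \<Omega> p r z))))"
proof -
  have psi: "(\<lambda>t::real. - 1 * (- ln (- t)) powr (- 1)) = psi"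
    and phi: "(\<lambda>t::real. - 2 * exp (- 1 / ((- t) powr (1 / (1/2) - 1)))) = phi"
    by (auto simp: psi_def phi_def)
  define lam where "lam t = Max {\<nu>::nat. 1 \<le> \<nu> \<and> - (1 / tower (\<nu> - 1)) \<le> - t}" for t :: real
  have main: "\<exists>\<epsilon>0 c. 0 < \<epsilon>0 \<and> 0 < c \<and> (\<forall>z\<in>\<Omega>. bdist \<Omega> z < - (- 1 / 2) \<longrightarrow>
      ereal (- c * exp (- \<epsilon>0 * real (lam (bdist \<Omega> z)))) \<le> rel_extremal \<Omega> p r z)"
    if r: "0 < r" and B: "cball p r \<subseteq> \<Omega>" for p r
  proof -
    obtain t0 c :: real and k0 :: nat where t0: "0 < t0" "t0 \<le> 1/4" and c: "0 < c"
      and decay: "\<And>k z. k0 \<le> k \<Longrightarrow> z \<in> \<Omega> \<Longrightarrow> bdist \<Omega> z < bscale t0 k \<Longrightarrow>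
         ereal (- (c / k)) \<le> rel_extremal \<Omega> p r z"
      using rel_extremal_decay[OF assms B r] by metis
    obtain n0 where n0: "\<And>n. n \<ge> n0 \<Longrightarrow> 1 / tower n < bscale t0 (2 ^ n)"
      using inverse_tower_less_bscale[OF t0] unfolding eventually_sequentially by blast
    have \<Omega>: "open \<Omega>" "bounded \<Omega>" "\<Omega> \<noteq> {}" using assms(1) by (auto simp: holder_domain_def)
    have ne: "frontier \<Omega> \<noteq> {}" by (rule bounded_frontier_nonempty) (use \<Omega> in auto)
    define N where "N = n0 + k0 + 1"
    \<comment> \<open>\<open>2 ^ N\<close> covers \<open>m \<le> N\<close>, where the constant
      competitor -1 suffices. For larger \<open>m\<close>, the index \<open>k = 2 ^ (m - 1)\<close>
      is admissible and \<open>c / k = 2 * c / 2 ^ m\<close>, whence the summand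
      \<open>2 * c\<close> and the exponent \<open>ln 2\<close>.\<close>
    define c' where "c' = 2 * c + 2 ^ N"
    show ?thesis
    proof (intro exI conjI ballI impI)
      show "0 < ln (2::real)" by simp
      show "0 < c'" using c by (simp add: c'_def add_pos_pos)
      fix z assume z: "z \<in> \<Omega>" "bdist \<Omega> z < - (- 1 / 2)"
      define m where "m = lam (bdist \<Omega> z)"
      have m: "1 \<le> m" "bdist \<Omega> z \<le> 1 / tower (m - 1)"
        using Max_tower[of "bdist \<Omega> z"] bdist_pos[OF \<Omega>(1) ne z(1)] z(2)
        unfolding m_def lam_def by auto
      have exp: "exp (- ln 2 * real m) = 1 / 2 ^ m"
        by (simp add: exp_minus exp_of_nat2_mult inverse_eq_divide)
      show "ereal (- c' * exp (- ln 2 * real (lam (bdist \<Omega> z)))) \<le> rel_extremal \<Omega> p r z"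
      proof (cases "m \<le> N")
        case True
        hence "(2::real) ^ m \<le> 2 ^ N" by (intro power_increasing) auto
        hence "2 ^ m \<le> c'" using c unfolding c'_def by linarith
        hence "- c' * (1 / 2 ^ m) \<le> -1" by simp
        moreover have "ereal (-1) \<le> rel_extremal \<Omega> p r z"
          by (rule rel_extremal_geI[where u = "\<lambda>_. -1"]) (auto intro: psh_real_const \<Omega>)
        ultimately show ?thesis unfolding m_def[symmetric] exp
          by (meson ereal_less_eq(3) order_trans)
      next
        case False
        have "k0 \<le> m - 1" using False by (simp add: N_def)
        also have "m - 1 \<le> 2 ^ (m - 1)" by (rule less_imp_le) simp
        finally have "k0 \<le> 2 ^ (m - 1)" .
        moreover have "bdist \<Omega> z < bscale t0 (2 ^ (m - 1))"
        proof -
          have "n0 \<le> m - 1" using False by (simp add: N_def)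
          thus ?thesis using m(2) n0 by (meson le_less_trans)
        qed
        ultimately have "ereal (- (c / real (2 ^ (m - 1)))) \<le> rel_extremal \<Omega> p r z"
          using decay z(1) by blast
        moreover have "c / real (2 ^ (m - 1)) = 2 * c * (1 / 2 ^ m)"
          using m(1) by (cases m) auto
        moreover have "2 * c * (1 / 2 ^ m) \<le> c' * (1 / 2 ^ m)"
          by (intro mult_right_mono) (auto simp: c'_def)
        ultimately have "- c' * (1 / 2 ^ m) \<le> - (c / real (2 ^ (m - 1)))"
          "ereal (- (c / real (2 ^ (m - 1)))) \<le> rel_extremal \<Omega> p r z" by auto
        thus ?thesis unfolding m_def[symmetric] exp
          by (meson ereal_less_eq(3) order_trans)
      qed
    qed
  qed
  have mono: "- (1 / tower n) \<le> - (1 / tower (Suc n))" for n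
  proof -
    have "tower n \<le> tower (Suc n)"
      unfolding tower.simps
      using exp_ge_add_one_self[of "tower n"] exp_ge_add_one_self[of "exp (tower n)"] by linarith
    thus ?thesis using tower_pos[of n] by (simp add: field_simps)
  qed
  have lim: "(\<lambda>\<nu>. - (1 / tower (\<nu> - 1))) \<longlonglongrightarrow> 0"
    using tendsto_neg_inverse_tower by (subst filterlim_sequentially_Suc[symmetric]) simp
  show ?thesis
  proof (rule exI[of _ "1/2"], rule exI[of _ 1], rule exI[of _ 1], rule exI[of _ 1], rule exI[of _ 2],
      rule exI[of _ "- 1 / 2"], unfold Let_def psi phi aseq_tower, intro conjI)
    show "\<forall>\<nu>\<ge>1. - (1 / tower (\<nu> - 1)) < 0 \<and> - (1 / tower (\<nu> - 1)) \<le> - (1 / tower (\<nu> + 1 - 1))"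
    proof (intro allI impI conjI)
      fix \<nu> :: nat assume "1 \<le> \<nu>"
      thus "- (1 / tower (\<nu> - 1)) \<le> - (1 / tower (\<nu> + 1 - 1))" using mono[of "\<nu> - 1"] by simp
      show "- (1 / tower (\<nu> - 1)) < 0" using tower_pos by simp
    qed
    show "\<forall>p r. 0 < r \<longrightarrow> cball p r \<subseteq> \<Omega> \<longrightarrow> (\<exists>\<epsilon>0 c. 0 < \<epsilon>0 \<and> 0 < c \<and> (\<forall>z\<in>\<Omega>. bdist \<Omega> z < - (- 1 / 2) \<longrightarrow>
        ereal (- c * exp (- \<epsilon>0 * real (Max {\<nu>. 1 \<le> \<nu> \<and> - (1 / tower (\<nu> - 1)) \<le> - bdist \<Omega> z})))
        \<le> rel_extremal \<Omega> p r z))"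
      using main unfolding lam_def by blast
  qed (use psi_bij psi_strict_mono lim in auto)
qed

end
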